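(* The map $B$, sending an affine permutation $w$ with $w^{-1}$ in the Sommers region $\mathcal{S}_m^n$ to the word $B(w)$, is a bijection from $\{w \in \widetilde{\mathfrak{S}}_n : w^{-1} \in \mathcal{S}_m^n\}$ onto the set $\mathcal{PW}_m^n$ of $(m,n)$-parking words.
   Context: Fix relatively prime positive integers $m$ and $n$. The affine symmetric group $\widetilde{\mathfrak{S}}_n$ is the group of bijections $w:\mathbb{Z}\to\mathbb{Z}$ with $w(i+n)=w(i)+n$ for all $i$ and $\sum_{i=1}^n w(i)=\binom{n+1}{2}$. The Sommers region $\mathcal{S}_m^n$ is the region bounded by the $n$ affine hyperplanes of height $m$ in the affine hyperplane arrangement of $\widetilde{\mathfrak{S}}_n$; an affine permutation $w^{-1}$ labels an alcove in $\mathcal{S}_m^n$ if and only if $w(i)-w(j)\neq m$ for all $i<j$. For such $w$, define $B(w)={\sf p}_1\cdots{\sf p}_n$ where, for $1\le i\le n$, ${\sf p}_i=\big|\{j\in\mathbb{N} : j>i,\ w(j)<w(i),\ w(i)-w(j)<m\}\big|$ (an affine analogue of the code of a permutation, the rational Pak–Stanley labeling). An $(m,n)$-parking word is a word ${\sf p}={\sf p}_0\cdots{\sf p}_{n-1}\in\{0,1,\ldots,m-1\}^n$ such that $|\{j : {\sf p}_j<i\}|\ge in/m$ for $1\le i\le m$; $\mathcal{PW}_m^n$ denotes the set of these. *)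

theory Defs
  imports "HOL-Analysis.Analysis"
begin

definition affine_perms :: "nat \<Rightarrow> (int \<Rightarrow> int) set" where
  "affine_perms n = {w. bij w \<and> (\<forall>i. w (i + int n) = w i + int n)
     \<and> (\<Sum>i=1..int n. w i) = int ((n + 1) choose 2)}"

(* A point (x_1, ..., x_n) of the hyperplane x_1 + ... + x_n = 0 of R^n is stored as its unique
   extension x : Z -> R with x (i + n) = x i + 1.  In these coordinates the affine hyperplane
   x_i - x_j = k (for i, j in {1..n} distinct, k an integer) is the set of points with
   x i = x (j + k n).  The affine symmetric group acts on the right by x |-> x o u. *)
definition affine_points :: "nat \<Rightarrow> (int \<Rightarrow> real) set" where
  "affine_points n = {x. (\<forall>i. x (i + int n) = x i + 1) \<and> (\<Sum>i=1..int n. x i) = 0}"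

(* x_1 < x_2 < ... < x_n < x_1 + 1 *)
definition fundamental_alcove :: "nat \<Rightarrow> (int \<Rightarrow> real) set" where
  "fundamental_alcove n = {x \<in> affine_points n. \<forall>i\<in>{1..int n}. x i < x (i + 1)}"

definition alcove :: "nat \<Rightarrow> (int \<Rightarrow> int) \<Rightarrow> (int \<Rightarrow> real) set" where
  "alcove n u = (\<lambda>x. x \<circ> u) ` fundamental_alcove n"

(* The hyperplane x a = x b (a < b) has height b - a, so the walls of the fundamental alcove are
   the hyperplanes of height 1, and those of height m are x i = x (i + m) for i = 1, ..., n.
   The (open) region they bound lies on the same side of each of them as the fundamental alcove. *)
definition sommers_region :: "nat \<Rightarrow> nat \<Rightarrow> (int \<Rightarrow> real) set" where
  "sommers_region m n = {x \<in> affine_points n. \<forall>i\<in>{1..int n}. x i < x (i + int m)}"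

definition pak_stanley :: "nat \<Rightarrow> nat \<Rightarrow> (int \<Rightarrow> int) \<Rightarrow> nat list" where
  "pak_stanley m n w =
     map (\<lambda>i. card {j::nat. j > i \<and> w (int j) < w (int i) \<and> w (int i) - w (int j) < int m}) [1..<n + 1]"

definition parking_words :: "nat \<Rightarrow> nat \<Rightarrow> nat list set" where
  "parking_words m n = {p. length p = n \<and> set p \<subseteq> {0..<m} \<and>
     (\<forall>i\<in>{1..m}. real (card {j. j < n \<and> p ! j < i}) \<ge> real (i * n) / real m)}"


lemma shift_mult:
  fixes f :: "int \<Rightarrow> 'a::ring_1" and c :: 'a
  assumes "\<And>i. f (i + int n) = f i + c"
  shows "f (i + k * int n) = f i + of_int k * c"
proof (induction k rule: int_induct[where k = 0])
  case (step1 k)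
  have "f (i + (k + 1) * int n) = f ((i + k * int n) + int n)" by (simp add: algebra_simps)
  also have "\<dots> = f (i + k * int n) + c" by (rule assms)
  finally show ?case using step1 by (simp add: algebra_simps)
next
  case (step2 k)
  have "f (i + k * int n) = f ((i + (k - 1) * int n) + int n)" by (simp add: algebra_simps)
  also have "\<dots> = f (i + (k - 1) * int n) + c" by (rule assms)
  finally show ?case using step2 by (simp add: algebra_simps)
qed simp

lemma sum_window_reindex:
  fixes f :: "int \<Rightarrow> 'a::ring_1"
  assumes n: "n > 0" and per: "\<And>i. f (i + int n) = f i"
    and inj: "inj u" and aff: "\<And>i. u (i + int n) = u i + int n"
  shows "(\<Sum>i=1..int n. f (u i)) = (\<Sum>i=1..int n. f i)"
proof -
  define g where "g i = (u i - 1) mod int n + 1" for i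
  have fg: "f (u i) = f (g i)" for i
  proof -
    have "u i = g i + ((u i - 1) div int n) * int n"
      unfolding g_def using div_mult_mod_eq[of "u i - 1" "int n"] by linarith
    then show ?thesis using shift_mult[of f n 0 "g i" "(u i - 1) div int n"] per by simp
  qed
  have "inj_on g {1..int n}"
  proof (rule inj_onI)
    fix i j assume ij: "i \<in> {1..int n}" "j \<in> {1..int n}" and "g i = g j"
    then have "(u i - 1) mod int n = (u j - 1) mod int n" by (simp add: g_def)
    then have "int n dvd u i - u j" by (metis mod_eq_dvd_iff diff_diff_eq2 diff_add_cancel)
    then obtain k where k: "u i - u j = int n * k" by (rule dvdE)
    then have "u i = u (j + k * int n)"
      using shift_mult[of u n "int n" j k] aff by (simp add: algebra_simps)
    then have "i = j + k * int n" using inj by (simp add: inj_eq)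
    then have "i mod int n = j mod int n" by simp
    then have "(i - 1) mod int n = (j - 1) mod int n" by (rule mod_diff_cong) simp
    then show "i = j" using ij by simp
  qed
  moreover have "g ` {1..int n} \<subseteq> {1..int n}"
    using n by (auto simp: g_def) (smt (verit) pos_mod_bound of_nat_0_less_iff)
  ultimately have "bij_betw g {1..int n} {1..int n}"
    by (simp add: bij_betw_def endo_inj_surj)
  then show ?thesis using fg by (simp add: sum.reindex_bij_betw)
qed

lemma sum_window: "(\<Sum>i=1..int n. i) = int ((n + 1) choose 2)"
proof (induction n)
  case (Suc n)
  have "{1..int (Suc n)} = insert (int (Suc n)) {1..int n}" by auto
  then show ?case using Suc by (simp add: numeral_2_eq_2)
qed (simp add: numeral_2_eq_2)

lemma affine_perms_inv:
  assumes n: "n > 0" and w: "w \<in> affine_perms n"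
  shows "inv w \<in> affine_perms n"
proof -
  have b: "bij w" and aff: "\<And>i. w (i + int n) = w i + int n"
    and s: "(\<Sum>i=1..int n. w i) = int ((n + 1) choose 2)"
    using w by (auto simp: affine_perms_def)
  have wi: "w (inv w i) = i" "inv w (w i) = i" for i
    using b by (simp_all add: bij_is_surj bij_is_inj surj_f_inv_f inv_f_f)
  have iaff: "inv w (i + int n) = inv w i + int n" for i
    by (metis aff wi)
  have "(\<Sum>i=1..int n. inv w (w i) - w i) = (\<Sum>i=1..int n. inv w i - i)"
    by (rule sum_window_reindex[OF n _ bij_is_inj[OF b] aff]) (simp add: iaff)
  then have "(\<Sum>i=1..int n. inv w i) = int ((n + 1) choose 2)"
    using s sum_window[of n] by (simp add: wi sum_subtractf)
  then show ?thesis using b iaff by (simp add: affine_perms_def bij_imp_bij_inv)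
qed

lemma affine_points_comp:
  assumes n: "n > 0" and x: "x \<in> affine_points n" and u: "u \<in> affine_perms n"
  shows "x \<circ> u \<in> affine_points n"
proof -
  have px: "\<And>i. x (i + int n) = x i + 1" and sx: "(\<Sum>i=1..int n. x i) = 0"
    using x by (auto simp: affine_points_def)
  have b: "inj u" and aff: "\<And>i. u (i + int n) = u i + int n"
    and s: "(\<Sum>i=1..int n. u i) = int ((n + 1) choose 2)"
    using u by (auto simp: affine_perms_def bij_is_inj)
  have "(\<Sum>i=1..int n. x (u i) - of_int (u i) / real n) = (\<Sum>i=1..int n. x i - of_int i / real n)"
    by (rule sum_window_reindex[where f = "\<lambda>i. x i - of_int i / real n", OF n _ b aff])
      (use n in \<open>simp add: px add_divide_distrib\<close>)
  moreover have "(\<Sum>i=1..int n. of_int (u i) / real n) = (\<Sum>i=1..int n. of_int i / real n)"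
    using s sum_window[of n] by (simp flip: sum_divide_distrib of_int_sum)
  ultimately show ?thesis using sx px aff by (simp add: sum_subtractf affine_points_def)
qed

lemma fundamental_alcove_strict_mono:
  assumes n: "n > 0" and x: "x \<in> fundamental_alcove n"
  shows "strict_mono x"
proof -
  have px: "\<And>i. x (i + int n) = x i + 1" and lt: "\<And>i. i \<in> {1..int n} \<Longrightarrow> x i < x (i + 1)"
    using x by (auto simp: affine_points_def fundamental_alcove_def)
  have step: "x i < x (i + 1)" for i
  proof -
    define r k where "r = (i - 1) mod int n + 1" and "k = (i - 1) div int n"
    have i: "i = r + k * int n"
      unfolding r_def k_def using div_mult_mod_eq[of "i - 1" "int n"] by linarith
    have "r \<in> {1..int n}"
      using n pos_mod_bound[of "int n" "i - 1"] pos_mod_sign[of "int n" "i - 1"]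
      unfolding r_def atLeastAtMost_iff by linarith
    from lt[OF this] show ?thesis
      using shift_mult[of x n 1 r k] shift_mult[of x n 1 "r + 1" k] px
      unfolding i by (simp add: algebra_simps)
  qed
  show ?thesis
  proof (rule strict_monoI)
    fix i j :: int assume "i < j"
    then show "x i < x j"
      by (induction j rule: int_gr_induct) (auto intro: step less_trans)
  qed
qed

(* With these conventions the alcoves in the Sommers region are the expected ones. *)
lemma alcove_inv_subset_sommers_region_iff:
  assumes n: "n > 0" and m: "m > 0" and w: "w \<in> affine_perms n"
  shows "alcove n (inv w) \<subseteq> sommers_region m n \<longleftrightarrow> (\<forall>i j. i < j \<longrightarrow> w i - w j \<noteq> int m)"
proof -
  have b: "bij w" and aff: "\<And>i. w (i + int n) = w i + int n"
    using w by (auto simp: affine_perms_def)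
  have wi: "w (inv w i) = i" "inv w (w i) = i" for i
    using b by (simp_all add: bij_is_surj bij_is_inj surj_f_inv_f inv_f_f)
  have iw: "inv w \<in> affine_perms n" by (rule affine_perms_inv[OF n w])
  then have iaff: "\<And>i. inv w (i + int n) = inv w i + int n" by (simp add: affine_perms_def)
  define c where "c = (real n + 1) / (2 * real n)"
  define p where "p i = of_int i / real n - c" for i :: int
  have "real ((n + 1) choose 2) = real n * (real n + 1) / 2"
    by (simp add: choose_two real_of_nat_div algebra_simps)
  then have "real_of_int (\<Sum>i=1..int n. i) = real n * (real n + 1) / 2"
    by (simp only: sum_window of_int_of_nat_eq)
  then have si: "(\<Sum>i=1..int n. real_of_int i) = real n * (real n + 1) / 2"
    by (simp only: of_int_sum)
  have "(\<Sum>i=1..int n. p i) = (\<Sum>i=1..int n. real_of_int i) / real n - real n * c"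
    by (simp add: p_def sum_subtractf flip: sum_divide_distrib)
  also have "\<dots> = 0"
    unfolding si c_def using n by (simp add: field_simps)
  finally have "(\<Sum>i=1..int n. p i) = 0" .
  then have p: "p \<in> fundamental_alcove n"
    using n by (auto simp: fundamental_alcove_def affine_points_def p_def field_simps)
  show ?thesis
  proof
    assume sub: "alcove n (inv w) \<subseteq> sommers_region m n"
    have "p \<circ> inv w \<in> sommers_region m n" using sub p by (auto simp: alcove_def)
    then have win: "inv w i < inv w (i + int m)" if "i \<in> {1..int n}" for i
      using that n fundamental_alcove_strict_mono[OF n p]
      by (auto simp: sommers_region_def strict_mono_less)
    have stable: "inv w i < inv w (i + int m)" for i
    proof -
      define r k where "r = (i - 1) mod int n + 1" and "k = (i - 1) div int n"
      have i: "i = r + k * int n"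
        unfolding r_def k_def using div_mult_mod_eq[of "i - 1" "int n"] by linarith
      have "r \<in> {1..int n}"
      using n pos_mod_bound[of "int n" "i - 1"] pos_mod_sign[of "int n" "i - 1"]
      unfolding r_def atLeastAtMost_iff by linarith
      from win[OF this] show ?thesis
        using shift_mult[of "inv w" n "int n" r k] shift_mult[of "inv w" n "int n" "r + int m" k] iaff
        unfolding i by (simp add: algebra_simps)
    qed
    show "\<forall>i j. i < j \<longrightarrow> w i - w j \<noteq> int m"
    proof (intro allI impI notI)
      fix i j :: int assume "i < j" and "w i - w j = int m"
      then have "w i = w j + int m" by simp
      then show False using stable[of "w j"] \<open>i < j\<close> by (metis wi(2) less_asym)
    qed
  next
    assume crit: "\<forall>i j. i < j \<longrightarrow> w i - w j \<noteq> int m"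
    have stable: "inv w i < inv w (i + int m)" for i
    proof (rule ccontr)
      assume "\<not> inv w i < inv w (i + int m)"
      moreover have "inv w i \<noteq> inv w (i + int m)"
        using m by (metis wi(1) add_cancel_left_right of_nat_0_eq_iff less_irrefl)
      ultimately have "inv w (i + int m) < inv w i" by simp
      then show False using crit wi(1)[of i] wi(1)[of "i + int m"] by fastforce
    qed
    show "alcove n (inv w) \<subseteq> sommers_region m n"
    proof
      fix y assume "y \<in> alcove n (inv w)"
      then obtain x where x: "x \<in> fundamental_alcove n" and y: "y = x \<circ> inv w"
        by (auto simp: alcove_def)
      have "y \<in> affine_points n"
        using affine_points_comp[OF n _ iw] x y by (simp add: fundamental_alcove_def)
      moreover have "y i < y (i + int m)" for i
        using stable fundamental_alcove_strict_mono[OF n x] by (simp add: y strict_mono_less)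
      ultimately show "y \<in> sommers_region m n" by (simp add: sommers_region_def)
    qed
  qed
qed

end

theory Submission
  imports Defs
begin

text \<open>
  Let \<open>w\<close> be an affine permutation with \<open>w i - w j \<noteq> m\<close> for \<open>i < j\<close>. Each set \<open>w ` {i..}\<close> is closed
  under adding \<open>m\<close> and has \<open>m\<close> minimal generators, one in each residue class modulo \<open>m\<close>. Then \<open>w i\<close> is
  one of them, its rank among them is the \<open>i\<close>-th letter of the Pak--Stanley word, and replacing it by
  \<open>w i + m\<close> yields the generators of \<open>w ` {i + 1..}\<close>. Hence the word, acting on sorted lists of \<open>m\<close>
  integers in this way, shifts the list of generators of \<open>w ` {1..}\<close> by \<open>n\<close>, and \<open>w\<close> amounts to a word
  together with such a fixed list.

  The action is monotone, commutes with translations and changes the sum by a constant. Therefore a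
  list that lies pointwise below its image is fixed, and pointwise maxima of fixed lists are fixed.
  Comparing prefix sums shows that only parking words have fixed lists and that orbits of parking
  words are bounded, which gives existence. Since \<open>m\<close> and \<open>n\<close> are coprime, the entries of a fixed list
  represent all residues modulo \<open>m\<close>; this makes the fixed list unique up to translation.
\<close>

section \<open>Bumping sorted lists\<close>

text \<open>
  If \<open>xs\<close> lists the minimal generators of a set closed under adding \<open>m\<close>, then \<open>bump m p xs\<close> lists
  those of the set without its \<open>p\<close>-th generator.
\<close>

definition bump :: "nat \<Rightarrow> nat \<Rightarrow> int list \<Rightarrow> int list" where
  "bump m p xs = insort (xs ! p + int m) (take p xs @ drop (Suc p) xs)"

abbreviation bumps :: "nat \<Rightarrow> nat list \<Rightarrow> int list \<Rightarrow> int list" where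
  "bumps m ps \<equiv> fold (bump m) ps"

text \<open>Stated with \<open>add_mset\<close> on both sides to avoid multiset subtraction; sums
  and residue counts are read off from it.\<close>

lemma add_mset_bump:
  assumes "p < length xs"
  shows "add_mset (xs ! p) (mset (bump m p xs)) = add_mset (xs ! p + int m) (mset xs)"
proof -
  have "mset xs = mset (take p xs @ xs ! p # drop (Suc p) xs)"
    using id_take_nth_drop[OF assms] by simp
  then show ?thesis by (simp add: bump_def)
qed

lemma length_bump: "p < length xs \<Longrightarrow> length (bump m p xs) = length xs"
  by (simp add: bump_def)

lemma sorted_remove_nth:
  assumes "sorted xs"
  shows "sorted (take p xs @ drop (Suc p) xs)"
proof (cases "p < length xs")
  case True
  have "sorted (take p xs @ xs ! p # drop (Suc p) xs)"
    using assms id_take_nth_drop[OF True] by simp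
  then show ?thesis by (auto simp: sorted_append)
qed (use assms in simp)

lemma sorted_bump: "sorted xs \<Longrightarrow> sorted (bump m p xs)"
  using sorted_remove_nth[of xs p] by (simp add: bump_def sorted_insort)

lemma sum_list_bump:
  assumes "p < length xs"
  shows "sum_list (bump m p xs) = sum_list xs + int m"
  using arg_cong[OF add_mset_bump[OF assms, of m], of sum_mset] by (simp add: sum_mset_sum_list)

lemma set_bump:
  assumes "p < length xs" "distinct xs"
  shows "set (bump m p xs) = insert (xs ! p + int m) (set xs - {xs ! p})"
proof -
  have xs: "xs = take p xs @ xs ! p # drop (Suc p) xs"
    using id_take_nth_drop[OF assms(1)] .
  have "distinct (take p xs @ xs ! p # drop (Suc p) xs)"
    using assms(2) xs by simp
  then have "set xs - {xs ! p} = set (take p xs @ drop (Suc p) xs)"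
    by (subst xs) auto
  then show ?thesis by (simp add: bump_def set_insort_key)
qed

lemma insort_map_add: "insort (v + t) (map (\<lambda>a. a + t) xs) = map (\<lambda>a. a + t) (insort v xs)"
  for t :: int
  by (induction xs) auto

lemma bump_map_add:
  assumes "p < length xs"
  shows "bump m p (map (\<lambda>a. a + t) xs) = map (\<lambda>a. a + t) (bump m p xs)"
proof -
  have "take p (map (\<lambda>a. a + t) xs) @ drop (Suc p) (map (\<lambda>a. a + t) xs)
      = map (\<lambda>a. a + t) (take p xs @ drop (Suc p) xs)"
    by (simp add: take_map drop_map)
  moreover have "map (\<lambda>a. a + t) xs ! p + int m = xs ! p + int m + t"
    using assms by simp
  ultimately show ?thesis by (simp only: bump_def insort_map_add)
qed

lemma list_all2_insort_mono:
  fixes u v :: int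
  assumes "list_all2 (\<le>) xs ys" "sorted xs" "sorted ys" "u \<le> v"
  shows "list_all2 (\<le>) (insort u xs) (insort v ys)"
  using assms
proof (induction arbitrary: u v rule: list_all2_induct)
  case (Cons a xs b ys)
  consider "u \<le> a" "v \<le> b" | "u \<le> a" "v > b" | "u > a" "v \<le> b" | "u > a" "v > b" by linarith
  then show ?case
  proof cases
    \<comment> \<open>If only \<open>v\<close> passes its head, then \<open>a \<le> b < v\<close>
      and \<open>a\<close> serves as the value inserted on the left; the next case is
      symmetric.\<close>
    case 2
    then have "list_all2 (\<le>) (insort a xs) (insort v ys)"
      using Cons by simp
    moreover have "insort a xs = a # xs" using Cons.prems by (simp add: insort_is_Cons)
    ultimately show ?thesis using 2 Cons.hyps by simp
  next
    case 3
    then have "list_all2 (\<le>) (insort u xs) (insort b ys)"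
      using Cons by simp
    moreover have "insort b ys = b # ys" using Cons.prems by (simp add: insort_is_Cons)
    ultimately show ?thesis using 3 Cons.prems by simp
  qed (use Cons in simp_all)
qed simp

lemma bump_mono:
  assumes "list_all2 (\<le>) xs ys" "sorted xs" "sorted ys" "p < length xs"
  shows "list_all2 (\<le>) (bump m p xs) (bump m p ys)"
  unfolding bump_def using assms
  by (intro list_all2_insort_mono sorted_remove_nth)
     (auto intro!: list_all2_appendI list_all2_takeI list_all2_dropI simp: list_all2_nthD)

text \<open>Reinserting the removed entry unchanged gives \<open>xs\<close> back; raising it only
  enlarges the result.\<close>

lemma bump_increasing:
  assumes "sorted xs" "p < length xs"
  shows "list_all2 (\<le>) xs (bump m p xs)"
proof -
  let ?r = "take p xs @ drop (Suc p) xs"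
  have "mset xs = mset (insort (xs ! p) ?r)"
    using arg_cong[OF id_take_nth_drop[OF assms(2)], of mset] by simp
  then have "insort (xs ! p) ?r = xs"
    using assms(1) sorted_remove_nth[OF assms(1)]
    by (metis properties_for_sort sorted_insort sort_key_id_if_sorted sorted_sort_id)
  then show ?thesis
    using list_all2_insort_mono[of ?r ?r "xs ! p" "xs ! p + int m"] sorted_remove_nth[OF assms(1)]
    by (simp add: bump_def list_all2_refl)
qed

section \<open>Words acting by iterated bumps\<close>

lemma length_bumps: "set ps \<subseteq> {..<length xs} \<Longrightarrow> length (bumps m ps xs) = length xs"
  by (induction ps arbitrary: xs) (auto simp: length_bump)

lemma sorted_bumps: "sorted xs \<Longrightarrow> sorted (bumps m ps xs)"
  by (induction ps arbitrary: xs) (auto simp: sorted_bump)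

lemma sum_list_bumps:
  "set ps \<subseteq> {..<length xs} \<Longrightarrow> sum_list (bumps m ps xs) = sum_list xs + int m * int (length ps)"
  by (induction ps arbitrary: xs) (auto simp: length_bump sum_list_bump algebra_simps)

lemma bumps_map_add:
  "set ps \<subseteq> {..<length xs} \<Longrightarrow> bumps m ps (map (\<lambda>a. a + t) xs) = map (\<lambda>a. a + t) (bumps m ps xs)"
  by (induction ps arbitrary: xs) (auto simp: length_bump bump_map_add)

lemma bumps_mono:
  assumes "list_all2 (\<le>) xs ys" "sorted xs" "sorted ys" "set ps \<subseteq> {..<length xs}"
  shows "list_all2 (\<le>) (bumps m ps xs) (bumps m ps ys)"
  using assms by (induction ps arbitrary: xs ys) (auto simp: bump_mono sorted_bump length_bump)

lemma bumps_increasing: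
  assumes "sorted xs" "set ps \<subseteq> {..<length xs}"
  shows "list_all2 (\<le>) xs (bumps m ps xs)"
  using assms
proof (induction ps arbitrary: xs)
  case (Cons p ps)
  then have "list_all2 (\<le>) xs (bump m p xs)" by (simp add: bump_increasing)
  moreover have "list_all2 (\<le>) (bump m p xs) (bumps m ps (bump m p xs))"
    using Cons by (simp add: sorted_bump length_bump)
  ultimately show ?case
    by (auto intro: list_all2_trans[rotated])
qed (simp add: list_all2_refl)

lemma sum_list_mono_list_all2:
  fixes xs ys :: "int list"
  assumes "list_all2 (\<le>) xs ys"
  shows "sum_list xs \<le> sum_list ys"
  using assms by (induction rule: list_all2_induct) auto

text \<open>Turns one-sided comparison of a list with its image into fixedness.\<close>

lemma list_all2_le_sum_list_eq:
  fixes xs ys :: "int list"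
  assumes "list_all2 (\<le>) xs ys" "sum_list xs = sum_list ys"
  shows "xs = ys"
  using assms
proof (induction rule: list_all2_induct)
  case (Cons x xs y ys)
  then show ?case using sum_list_mono_list_all2[of xs ys] by auto
qed simp

lemma insort_append_right:
  assumes "\<forall>a\<in>set A. a < v"
  shows "insort v (A @ B) = A @ insort v B"
  using assms by (induction A) auto

lemma insort_append_left:
  assumes "\<forall>b\<in>set B. v \<le> b"
  shows "insort v (A @ B) = insort v A @ B"
  using assms insort_is_Cons[where f = "\<lambda>a. a" and xs = B and a = v] by (induction A) auto

section \<open>Prefix sums\<close>

lemma bump_append_right:
  assumes "sorted (A @ B)" "length A \<le> p" "p < length (A @ B)" "m > 0"
  shows "bump m p (A @ B) = A @ bump m (p - length A) B"
proof -
  \<comment> \<open>\<open>insort\<close> stops before equal entries, so staying right of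
    \<open>A\<close> needs strictness, hence \<open>m > 0\<close>.\<close>
  have "\<forall>a\<in>set A. a < (A @ B) ! p + int m"
  proof
    fix a assume "a \<in> set A"
    moreover have "(A @ B) ! p \<in> set B" using assms by (simp add: nth_append)
    ultimately have "a \<le> (A @ B) ! p" using assms(1) by (simp add: sorted_append)
    then show "a < (A @ B) ! p + int m" using assms(4) by simp
  qed
  moreover have "take p (A @ B) @ drop (Suc p) (A @ B)
      = A @ (take (p - length A) B @ drop (Suc (p - length A)) B)"
    using assms(2) by (simp add: Suc_diff_le)
  ultimately show ?thesis
    using assms(2) by (simp only: bump_def insort_append_right) (simp add: nth_append)
qed

lemma bump_append_left:
  assumes "\<forall>b\<in>set B. A ! p + int m \<le> b" "p < length A"
  shows "bump m p (A @ B) = bump m p A @ B"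
  using assms insort_append_left[of B "A ! p + int m" "take p A @ drop (Suc p) A"]
  by (simp add: bump_def nth_append)

text \<open>Equality holds if \<open>v\<close> lands in the prefix; otherwise it has passed the last
  prefix entry, which is then below \<open>v\<close>.\<close>

lemma sum_take_insort_le:
  "sum_list (take (Suc j) (insort v ys)) \<le> v + sum_list (take j ys)" for v :: int
proof (induction ys arbitrary: j)
  case (Cons a ys)
  then show ?case using Cons.IH[of "j - 1"] by (cases j) auto
qed simp

text \<open>The raised entry may leave the prefix and let a smaller one in, hence only an
  inequality.\<close>

lemma sum_take_bump_le:
  assumes "sorted xs" "p < length xs" "i \<le> length xs" "m > 0"
  shows "sum_list (take i (bump m p xs)) \<le> sum_list (take i xs) + (if p < i then int m else 0)"
proof (cases "p < i")
  case True
  then obtain j where i: "i = Suc j" by (cases i) auto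
  have "take i xs = take p xs @ xs ! p # take (j - p) (drop (Suc p) xs)"
    using True assms(2) i id_take_nth_drop[of p "take i xs"] assms(3)
    by (simp add: min_def take_drop)
  then show ?thesis
    using sum_take_insort_le[of j "xs ! p + int m" "take p xs @ drop (Suc p) xs"] True i assms(2)
    by (simp add: bump_def)
next
  case False
  then have "bump m p (take i xs @ drop i xs) = take i xs @ bump m (p - i) (drop i xs)"
    using assms bump_append_right[of "take i xs" "drop i xs" p m] by simp
  then show ?thesis using False assms(3) by simp
qed

lemma sum_take_bumps_le:
  assumes "sorted xs" "set ps \<subseteq> {..<length xs}" "i \<le> length xs" "m > 0"
  shows "sum_list (take i (bumps m ps xs))
    \<le> sum_list (take i xs) + int m * int (length (filter (\<lambda>p. p < i) ps))"
  using assms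
proof (induction ps arbitrary: xs)
  case (Cons p ps)
  then have "sum_list (take i (bumps m ps (bump m p xs)))
    \<le> sum_list (take i (bump m p xs)) + int m * int (length (filter (\<lambda>p. p < i) ps))"
    by (simp add: sorted_bump length_bump)
  then show ?case using sum_take_bump_le[of xs p i m] Cons.prems
    by (simp add: algebra_simps split: if_splits)
qed simp

text \<open>The gap is a budget: each letter uses at most one \<open>m\<close> of it. Entries of
  \<open>A\<close> thus never pass \<open>B\<close>, and the bound on prefix sums becomes an
  equality.\<close>

lemma sum_bumps_gap:
  assumes "sorted (A @ B)" "set ps \<subseteq> {..<length (A @ B)}" "m > 0"
    and "\<forall>a\<in>set A. \<forall>b\<in>set B. a + int m * int (length ps) \<le> b"
  shows "sum_list (take (length A) (bumps m ps (A @ B)))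
    = sum_list A + int m * int (length (filter (\<lambda>p. p < length A) ps))"
  using assms
proof (induction ps arbitrary: A B)
  case (Cons p ps)
  show ?case
  proof (cases "p < length A")
    case True
    have "A ! p + int m \<le> A ! p + int m * int (length (p # ps))"
      by (simp add: algebra_simps)
    then have "\<forall>b\<in>set B. A ! p + int m \<le> b"
      using Cons.prems(4) True by (meson nth_mem order_trans)
    then have e: "bump m p (A @ B) = bump m p A @ B"
      using True by (rule bump_append_left)
    have "a + int m * int (length ps) \<le> b" if "a \<in> set (bump m p A)" "b \<in> set B" for a b
    proof -
      have "a \<in># add_mset (A ! p + int m) (mset A)"
        using that(1) add_mset_bump[OF True, of m] by (metis insert_iff set_mset_add_mset_insert set_mset_mset)
      then have "a = A ! p + int m \<or> a \<in> set A" by auto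
      moreover have "A ! p + int m * int (length (p # ps)) \<le> b"
        using Cons.prems(4) True that(2) by (meson nth_mem)
      moreover have "a + int m * int (length (p # ps)) \<le> b" if "a \<in> set A"
        using Cons.prems(4) that \<open>b \<in> set B\<close> by blast
      ultimately show ?thesis by (auto simp: algebra_simps)
    qed
    moreover have "sorted (bump m p A @ B)" using sorted_bump[OF Cons.prems(1)] e by metis
    ultimately show ?thesis
      using Cons.IH[of "bump m p A" B] Cons.prems(2,3) True e sum_list_bump[OF True, of m]
      by (simp add: length_bump algebra_simps)
  next
    case False
    then have p: "p - length A < length B" using Cons.prems(2) by auto
    have e: "bump m p (A @ B) = A @ bump m (p - length A) B"
      using Cons.prems(1-3) False by (intro bump_append_right) auto
    have "a + int m * int (length ps) \<le> b" if "a \<in> set A" "b \<in> set (bump m (p - length A) B)" for a b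
    proof -
      have "b \<in># add_mset (B ! (p - length A) + int m) (mset B)"
        using that(2) add_mset_bump[OF p, of m] by (metis insert_iff set_mset_add_mset_insert set_mset_mset)
      then have "b = B ! (p - length A) + int m \<or> b \<in> set B" by auto
      then obtain b' where "b' \<in> set B" "b' \<le> b" using p nth_mem by fastforce
      then have "a + int m * int (length (p # ps)) \<le> b"
        using Cons.prems(4) that(1) by force
      then show ?thesis by (simp add: algebra_simps)
    qed
    moreover have "sorted (A @ bump m (p - length A) B)" using sorted_bump[OF Cons.prems(1)] e by metis
    ultimately show ?thesis
      using Cons.IH[of A "bump m (p - length A) B"] Cons.prems(2,3) False e p
      by (simp add: length_bump)
  qed
qed simp

section \<open>Invariant subsets and pointwise maxima\<close>

lemma finite_self_map_invariant_subset:
  assumes "finite X" "X \<noteq> {}" "F ` X \<subseteq> X"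
  obtains P where "P \<subseteq> X" "P \<noteq> {}" "F ` P = P"
proof -
  have "\<exists>P\<subseteq>X. P \<noteq> {} \<and> F ` P = P"
    using assms
  proof (induction X rule: finite_psubset_induct)
    case (psubset X)
    show ?case
    proof (cases "F ` X = X")
      case False
      then have "F ` X \<subset> X" using psubset.prems by blast
      then show ?thesis
        using psubset.IH[of "F ` X"] psubset.prems by (meson image_is_empty image_mono psubset_imp_subset subset_trans)
    qed (use psubset in blast)
  qed
  then show thesis using that by blast
qed

lemma sum_list_ge_member:
  fixes xs :: "int list"
  assumes "x \<in> set xs" "\<forall>a\<in>set xs. L \<le> a"
  shows "x + int (length xs - 1) * L \<le> sum_list xs"
  using assms
proof (induction xs)
  case (Cons a xs)
  have "int (length xs) * L \<le> sum_list xs"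
    using Cons.prems(2) sum_list_mono[of xs "\<lambda>_. L" "\<lambda>a. a"] by (simp add: sum_list_triv)
  moreover have "int (length xs) * L = L + int (length xs - 1) * L" if "x \<in> set xs"
    using that by (cases xs) (auto simp: algebra_simps)
  ultimately show ?case using Cons by fastforce
qed simp

text \<open>The join in the pointwise order; it stays sorted, so monotonicity of bumps applies to
  it.\<close>

lemma sorted_Max_list:
  assumes "finite P" "P \<noteq> {}" "\<forall>xs\<in>P. length xs = m \<and> sorted xs"
  obtains y :: "int list" where "length y = m" "sorted y" "\<forall>xs\<in>P. list_all2 (\<le>) xs y"
    "\<And>z. length z = m \<Longrightarrow> \<forall>xs\<in>P. list_all2 (\<le>) xs z \<Longrightarrow> list_all2 (\<le>) y z"
proof
  let ?y = "map (\<lambda>i. Max ((\<lambda>xs. xs ! i) ` P)) [0..<m]"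
  show "length ?y = m" by simp
  show "sorted ?y"
    unfolding sorted_iff_nth_mono
  proof (intro allI impI)
    fix i j assume ij: "i \<le> j" "j < length ?y"
    have "xs ! i \<le> Max ((\<lambda>xs. xs ! j) ` P)" if "xs \<in> P" for xs
    proof -
      have "xs ! i \<le> xs ! j" using assms(3) that ij by (simp add: sorted_iff_nth_mono)
      also have "\<dots> \<le> Max ((\<lambda>xs. xs ! j) ` P)" using assms(1) that by simp
      finally show ?thesis .
    qed
    then show "?y ! i \<le> ?y ! j" using ij assms(1,2) by simp
  qed
  show "\<forall>xs\<in>P. list_all2 (\<le>) xs ?y"
    using assms by (auto simp: list_all2_conv_all_nth)
  show "list_all2 (\<le>) ?y z" if "length z = m" "\<forall>xs\<in>P. list_all2 (\<le>) xs z" for z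
    using assms that by (auto simp: list_all2_conv_all_nth)
qed

section \<open>Fixed lists of a word\<close>

lemma sum_list_map_add: "sum_list (map (\<lambda>a. a + t) xs) = sum_list xs + int (length xs) * t"
  by (induction xs) (auto simp: algebra_simps)

text \<open>Translation by \<open>n\<close> raises the prefix sum by exactly \<open>i * n\<close>,
  the bumps by at most \<open>m\<close> per letter below \<open>i\<close>.\<close>

lemma fixed_list_parking:
  assumes "sorted y" "set p \<subseteq> {..<length y}" "i \<le> length y" "m > 0"
    and "bumps m p y = map (\<lambda>a. a + int n) y"
  shows "i * n \<le> m * length (filter (\<lambda>q. q < i) p)"
proof -
  have "sum_list (take i y) + int i * int n \<le> sum_list (take i y) + int m * int (length (filter (\<lambda>q. q < i) p))"
    using sum_take_bumps_le[OF assms(1-4)] assms(3,5) by (simp add: take_map sum_list_map_add)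
  then have "int (i * n) \<le> int (m * length (filter (\<lambda>q. q < i) p))" by simp
  then show ?thesis by linarith
qed

text \<open>
  The set \<open>X\<close> below is invariant because a prefix sum \<open>S i\<close> can only be near its lower bound when the
  strictly convex \<open>c\<close> forces a large gap after the first \<open>i\<close> entries; across a gap \<open>S i\<close> grows by
  exactly \<open>m\<close> for each letter below \<open>i\<close>, which the parking condition makes enough. The pointwise
  maximum \<open>y\<close> of a subset \<open>P\<close> of \<open>X\<close> with \<open>F ` P = P\<close> satisfies \<open>y \<le> F y\<close>, and equality holds because
  \<open>F\<close> preserves sums.
\<close>

lemma parking_list_fixed_exists:
  assumes "m > 0" "length p = n" "set p \<subseteq> {..<m}"
    and parking: "\<And>i. i \<le> m \<Longrightarrow> i * n \<le> m * length (filter (\<lambda>q. q < i) p)"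
  obtains y where "length y = m" "sorted y" "bumps m p y = map (\<lambda>a. a + int n) y"
proof -
  \<comment> \<open>The \<open>n\<close> letters add \<open>m * n\<close> to the sum; subtracting
    \<open>n\<close> from each of \<open>m\<close> entries removes it again.\<close>
  define F where "F xs = map (\<lambda>a. a + (- int n)) (bumps m p xs)" for xs
  define S where "S i xs = sum_list (take i xs)" for i and xs :: "int list"
  define K where "K = 2 * (int n * int m)"
  define c where "c i = K * (int i)\<^sup>2" for i
  \<comment> \<open>The bound is 0 at \<open>i = m\<close>, matching the zero sum, and nonpositive
    before, which admits the zero list.\<close>
  define X where "X = {xs. length xs = m \<and> sorted xs \<and> sum_list xs = 0 \<and> (\<forall>i\<le>m. c i - c m \<le> S i xs)}"
  have c0: "c 0 = 0" by (simp add: c_def)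
  have cm: "c i \<le> c m" if "i \<le> m" for i
    using that by (auto simp: c_def K_def intro!: mult_left_mono power_mono)
  have sumF: "sum_list (F xs) = sum_list xs" if "length xs = m" for xs
    using that assms(2,3) sum_list_bumps[of p xs m] length_bumps[of p xs m]
    by (simp only: F_def sum_list_map_add)
  have lenF: "length (F xs) = m" and sortF: "sorted xs \<Longrightarrow> sorted (F xs)"
    and monoF: "\<And>ys. sorted xs \<Longrightarrow> sorted ys \<Longrightarrow> list_all2 (\<le>) xs ys \<Longrightarrow> list_all2 (\<le>) (F xs) (F ys)"
    if "length xs = m" for xs
    using that assms length_bumps[of p xs m] sorted_bumps[of xs m p] sum_list_bumps[of p xs m]
      bumps_mono[of xs _ p m]
    by (auto simp: F_def sorted_map list_all2_map1 list_all2_map2)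
  have SF: "S i (F xs) = S i (bumps m p xs) - int i * int n" if "length xs = m" "i \<le> m" for i xs
    using that assms sum_list_map_add[of "- int n"] by (simp add: S_def F_def take_map length_bumps)
  have FX: "F xs \<in> X" if "xs \<in> X" for xs
  proof -
    have len: "length xs = m" and srt: "sorted xs" and sum0: "sum_list xs = 0"
      and low: "\<And>i. i \<le> m \<Longrightarrow> c i - c m \<le> S i xs"
      using that by (auto simp: X_def)
    have "c i - c m \<le> S i (F xs)" if i: "i \<le> m" for i
    proof -
      consider "i = 0" | "i = m" | "0 < i" "i < m" "c i - c m + int n * int m \<le> S i xs"
        | "0 < i" "i < m" "S i xs < c i - c m + int n * int m"
        using i by linarith
      then show ?thesis
      proof cases
        case 1
        then show ?thesis using cm[of 0] by (simp add: S_def c0)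
      next
        case 2
        then show ?thesis using lenF[OF len] sumF[OF len] sum0 by (simp add: S_def)
      next
        case 3
        \<comment> \<open>Bumps lower no prefix sum, so \<open>F\<close> costs at most
          \<open>i * n\<close>, which the slack \<open>n * m\<close> covers.\<close>
        have "S i xs \<le> S i (bumps m p xs)"
          unfolding S_def using bumps_increasing[OF srt, of p m] assms(3) len
          by (intro sum_list_mono_list_all2 list_all2_takeI) auto
        moreover have "int i * int n \<le> int n * int m" using i by (simp add: mult.commute[of "int n"] mult_right_mono)
        ultimately show ?thesis using 3 SF[OF len i] by linarith
      next
        case 4
        obtain j where j: "i = Suc j" using 4 by (cases i) auto
        have S1: "S (Suc i) xs = S i xs + xs ! i" and S2: "S i xs = S j xs + xs ! j"
          using 4(2) len take_Suc_conv_app_nth[of i xs] take_Suc_conv_app_nth[of j xs]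
          by (simp_all add: S_def j)
        \<comment> \<open>The jump from \<open>xs ! j\<close> to \<open>xs ! i\<close> is the second
          difference of \<open>S\<close>: at least that of \<open>c\<close>, which is
          \<open>2 * K\<close>, less twice the slack \<open>n * m\<close>.\<close>
        have "c (Suc i) + c j - 2 * c i = 2 * K"
          by (simp add: c_def j power2_eq_square algebra_simps)
        moreover have "c (Suc i) - c m \<le> S (Suc i) xs" "c j - c m \<le> S j xs"
          using low 4 j by simp_all
        moreover have "0 \<le> int n * int m" by simp
        ultimately have "xs ! j + int n * int m < xs ! i"
          using S1 S2 4(3) unfolding K_def by linarith
        then have gap: "a + int m * int (length p) \<le> b" if "a \<in> set (take i xs)" "b \<in> set (drop i xs)" for a b
        proof -
          obtain k where "k < i" "a = xs ! k"
            using \<open>a \<in> _\<close> by (auto simp: in_set_conv_nth)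
          then have "a \<le> xs ! j" using srt 4 len j by (simp add: sorted_iff_nth_mono)
          moreover obtain l where "b = xs ! (i + l)" "i + l < m"
            using \<open>b \<in> _\<close> len by (auto simp: in_set_conv_nth)
          then have "xs ! i \<le> b" using srt len by (simp add: sorted_iff_nth_mono)
          ultimately show ?thesis using \<open>xs ! j + int n * int m < xs ! i\<close> assms(2)
            by (simp add: mult.commute)
        qed
        have "S i (bumps m p xs) = S i xs + int m * int (length (filter (\<lambda>q. q < i) p))"
          unfolding S_def
          using sum_bumps_gap[of "take i xs" "drop i xs" p m] srt assms(1,3) len i gap by simp
        moreover have "int i * int n \<le> int m * int (length (filter (\<lambda>q. q < i) p))"
          using parking[OF i] by (metis of_nat_le_iff of_nat_mult)
        ultimately show ?thesis using SF[OF len i] low[OF i] by linarith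
      qed
    qed
    then show ?thesis using lenF[OF len] sortF[OF len srt] sumF[OF len] sum0 by (simp add: X_def)
  qed
  \<comment> \<open>\<open>S 1\<close> bounds the least entry from below; the zero sum then bounds
    every entry from above.\<close>
  have "finite X"
  proof (rule finite_subset)
    let ?L = "c 1 - c m"
    show "X \<subseteq> {xs. set xs \<subseteq> {?L..- (int (m - 1) * ?L)} \<and> length xs = m}"
    proof
      fix xs assume "xs \<in> X"
      then have len: "length xs = m" and srt: "sorted xs" and sum0: "sum_list xs = 0"
        and "?L \<le> S 1 xs" using assms(1) by (auto simp: X_def)
      moreover have "S 1 xs = xs ! 0" using len assms(1) by (cases xs) (auto simp: S_def)
      ultimately have L: "?L \<le> xs ! 0" by simp
      have low: "\<forall>a\<in>set xs. ?L \<le> a"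
      proof
        fix a assume "a \<in> set xs"
        then have "xs ! 0 \<le> a" using srt by (auto simp: in_set_conv_nth sorted_iff_nth_mono)
        then show "?L \<le> a" using L by linarith
      qed
      then have "a \<le> - (int (m - 1) * ?L)" if "a \<in> set xs" for a
        using sum_list_ge_member[OF that low] sum0 len by simp
      then show "xs \<in> {xs. set xs \<subseteq> {?L..- (int (m - 1) * ?L)} \<and> length xs = m}"
        using low len by auto
    qed
  qed (rule finite_lists_length_eq, simp)
  moreover have "replicate m 0 \<in> X"
    using cm by (simp add: X_def S_def sum_list_replicate)
  ultimately obtain P where P: "P \<subseteq> X" "P \<noteq> {}" "F ` P = P"
    by (metis finite_self_map_invariant_subset FX image_subsetI empty_iff)
  have "finite P" using P(1) \<open>finite X\<close> finite_subset by blast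
  moreover have PX: "length xs = m \<and> sorted xs" if "xs \<in> P" for xs using P(1) that by (auto simp: X_def)
  ultimately obtain y where y: "length y = m" "sorted y" "\<forall>xs\<in>P. list_all2 (\<le>) xs y"
    and least: "\<And>z. length z = m \<Longrightarrow> \<forall>xs\<in>P. list_all2 (\<le>) xs z \<Longrightarrow> list_all2 (\<le>) y z"
    using sorted_Max_list[of P m] P(2) by blast
  \<comment> \<open>Members of \<open>P\<close> are images of members, so \<open>F y\<close> is an
    upper bound of \<open>P\<close> by monotonicity.\<close>
  have "list_all2 (\<le>) xs (F y)" if "xs \<in> P" for xs
  proof -
    obtain xs' where "xs' \<in> P" "xs = F xs'" using P(3) \<open>xs \<in> P\<close> by blast
    then show ?thesis using monoF[of xs' y] PX y by blast
  qed
  then have "list_all2 (\<le>) y (F y)" using least lenF[OF y(1)] by blast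
  then have "y = F y" using sumF[OF y(1)] by (intro list_all2_le_sum_list_eq) auto
  moreover have "map (\<lambda>a. a + int n) (F y) = bumps m p y"
    by (simp add: F_def comp_def)
  ultimately show ?thesis using that y(1,2) by metis
qed

section \<open>Residues modulo \<open>m\<close> and uniqueness of fixed lists\<close>

lemma length_filter_dvd_bumps:
  assumes "set p \<subseteq> {..<length xs}"
  shows "length (filter (\<lambda>a. int m dvd a - r) (bumps m p xs)) = length (filter (\<lambda>a. int m dvd a - r) xs)"
  using assms
proof (induction p arbitrary: xs)
  case (Cons q p)
  have "int m dvd xs ! q + int m - r \<longleftrightarrow> int m dvd xs ! q - r"
    by (metis diff_add_eq dvd_add_triv_right_iff)
  then have "size (filter_mset (\<lambda>a. int m dvd a - r) (mset (bump m q xs)))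
    = size (filter_mset (\<lambda>a. int m dvd a - r) (mset xs))"
    using arg_cong[OF add_mset_bump[of q xs m], of "\<lambda>M. size (filter_mset (\<lambda>a. int m dvd a - r) M)"] Cons.prems
    by (simp split: if_splits)
  then have "length (filter (\<lambda>a. int m dvd a - r) (bump m q xs)) = length (filter (\<lambda>a. int m dvd a - r) xs)"
    by (simp flip: mset_filter)
  then show ?case using Cons by (simp add: length_bump)
qed simp

text \<open>Bumps preserve the number of entries in each residue class, and fixedness makes it
  invariant under shifts by \<open>n\<close>. Since \<open>n\<close> generates the residues, all
  classes are equally occupied, hence once each.\<close>

lemma fixed_list_transversal:
  assumes "m > 0" "coprime m n" "length y = m" "set p \<subseteq> {..<m}"
    and fix_y: "bumps m p y = map (\<lambda>a. a + int n) y"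
  shows "distinct y" and "bij_betw (\<lambda>a. a mod int m) (set y) {0..<int m}"
proof -
  define c where "c r = length (filter (\<lambda>a. int m dvd a - r) y)" for r
  have cn: "c (r - int n) = c r" for r
    using length_filter_dvd_bumps[of p y m r] assms(3,4)
    by (simp add: c_def fix_y filter_map comp_def algebra_simps)
  have ckn: "c (r - int k * int n) = c r" for r k
  proof (induction k)
    case (Suc k)
    then show ?case using cn[of "r - int k * int n"] by (simp add: algebra_simps)
  qed simp
  have shift: "c r = c s" if "int m dvd r - s" for r s
  proof -
    have "int m dvd a - r \<longleftrightarrow> int m dvd a - s" for a
      using dvd_add_left_iff[OF that, of "a - r"] by simp
    then show ?thesis by (simp add: c_def)
  qed
  have const: "c r = c s" for r s
  proof -
    \<comment> \<open>\<open>x\<close> inverts \<open>n\<close> modulo \<open>m\<close>, so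
      \<open>(r - s) * x\<close> steps of \<open>n\<close> lead from \<open>r\<close> down to the
      class of \<open>s\<close>.\<close>
    obtain x v where "x * int n + v * int m = 1"
      using bezout_int[of "int n" "int m"] assms(2) by (auto simp: coprime_commute coprime_iff_gcd_eq_1)
    then have "int n * x - 1 = int m * (- v)" by (simp add: algebra_simps)
    then have x: "int m dvd int n * x - 1" by simp
    define k where "k = nat (((r - s) * x) mod int m)"
    have "int m dvd (r - s) * x - int k"
      using assms(1) dvd_minus_mod[of "int m" "(r - s) * x"] by (simp add: k_def)
    then have "int m dvd ((r - s) * x - int k) * int n - (r - s) * (int n * x - 1)"
      using x by (intro dvd_diff) auto
    also have "((r - s) * x - int k) * int n - (r - s) * (int n * x - 1) = (r - int k * int n) - s"
      by (simp add: algebra_simps)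
    finally show ?thesis using shift[of "r - int k * int n" s] ckn[of r k] by simp
  qed
  have surj: "(\<lambda>a. a mod int m) ` set y = {0..<int m}"
  proof
    show "(\<lambda>a. a mod int m) ` set y \<subseteq> {0..<int m}" using assms(1) by auto
    show "{0..<int m} \<subseteq> (\<lambda>a. a mod int m) ` set y"
    proof
      fix r assume r: "r \<in> {0..<int m}"
      have "hd y \<in> set y" using assms(1,3) by (cases y) auto
      then have "hd y \<in> set (filter (\<lambda>a. int m dvd a - hd y) y)" by simp
      then have "c (hd y) > 0" unfolding c_def by (rule length_pos_if_in_set)
      then have "c r > 0" using const[of r "hd y"] by simp
      then obtain a where "a \<in> set y" "int m dvd a - r"
        unfolding c_def by (auto simp: filter_empty_conv)
      then have "a mod int m = r mod int m" by (simp only: mod_eq_dvd_iff)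
      then have "a mod int m = r" using r by simp
      then show "r \<in> (\<lambda>a. a mod int m) ` set y" using \<open>a \<in> set y\<close> by blast
    qed
  qed
  then have "m \<le> card (set y)" using card_image_le[of "set y" "\<lambda>a. a mod int m"] by simp
  then have "card (set y) = m" using card_length[of y] assms(3) by simp
  then show "distinct y" using assms(3) by (simp add: card_distinct)
  have "inj_on (\<lambda>a. a mod int m) (set y)"
    using surj \<open>card (set y) = m\<close> by (intro eq_card_imp_inj_on) auto
  then show "bij_betw (\<lambda>a. a mod int m) (set y) {0..<int m}" using surj by (simp add: bij_betw_def)
qed

text \<open>The entries form a complete residue system.\<close>

lemma fixed_list_sum_mod:
  assumes "m > 0" "coprime m n" "length y = m" "set p \<subseteq> {..<m}"
    and "bumps m p y = map (\<lambda>a. a + int n) y"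
  shows "sum_list y mod int m = (\<Sum>r\<in>{0..<int m}. r) mod int m"
proof -
  note t = fixed_list_transversal[OF assms]
  have "sum_list y = (\<Sum>a\<in>set y. a)"
    using sum_list_distinct_conv_sum_set[OF t(1), of "\<lambda>a. a"] by simp
  also have "\<dots> mod int m = (\<Sum>a\<in>set y. a mod int m) mod int m" by (simp add: mod_sum_eq)
  also have "(\<Sum>a\<in>set y. a mod int m) = (\<Sum>r\<in>{0..<int m}. r)"
    by (rule sum.reindex_bij_betw[OF t(2)])
  finally show ?thesis .
qed

text \<open>
  The pointwise maximum \<open>z t\<close> of \<open>x\<close> and \<open>y + t\<close> is again fixed, so its sum modulo \<open>m\<close> does not depend
  on \<open>t\<close>. Passing from \<open>t\<close> to \<open>t + 1\<close> therefore increases either no entry or all of them.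
\<close>

lemma fixed_list_unique:
  assumes "m > 0" "coprime m n" "length p = n" "set p \<subseteq> {..<m}"
    and x: "length x = m" "sorted x" "bumps m p x = map (\<lambda>a. a + int n) x"
    and y: "length y = m" "sorted y" "bumps m p y = map (\<lambda>a. a + int n) y"
  obtains t where "x = map (\<lambda>a. a + t) y"
proof -
  define z where "z t = map (\<lambda>k. max (x ! k) (y ! k + t)) [0..<m]" for t
  \<comment> \<open>The positions where \<open>z (t + 1)\<close> exceeds \<open>z t\<close>, there
    by exactly 1.\<close>
  define D where "D t = {k\<in>{..<m}. x ! k \<le> y ! k + t}" for t
  have lenz: "length (z t) = m" for t by (simp add: z_def)
  have sortz: "sorted (z t)" for t
    using x(1,2) y(1,2) by (auto simp: z_def sorted_iff_nth_mono intro: max.coboundedI1 max.coboundedI2)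
  have fixz: "bumps m p (z t) = map (\<lambda>a. a + int n) (z t)" for t
  proof -
    \<comment> \<open>The image of \<open>z t\<close> dominates both images, hence
      \<open>z t\<close> translated by \<open>n\<close>; equal sums give equality.\<close>
    have "list_all2 (\<le>) (bumps m p x) (bumps m p (z t))"
      using x(1,2) sortz assms(4) by (intro bumps_mono) (auto simp: z_def list_all2_conv_all_nth)
    moreover have "list_all2 (\<le>) (bumps m p (map (\<lambda>a. a + t) y)) (bumps m p (z t))"
      using y(1,2) sortz assms(4)
      by (intro bumps_mono) (auto simp: z_def list_all2_conv_all_nth sorted_map)
    moreover have "bumps m p (map (\<lambda>a. a + t) y) = map (\<lambda>a. a + t + int n) y"
      using y(1) assms(4) by (simp add: bumps_map_add y(3) comp_def algebra_simps)
    ultimately have "list_all2 (\<le>) (map (\<lambda>a. a + int n) (z t)) (bumps m p (z t))"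
      using x(1,3) y(1) by (auto simp: z_def list_all2_conv_all_nth max_def)
    then show ?thesis
      using sum_list_bumps[of p "z t" m] assms(3,4) lenz[of t]
      by (intro list_all2_le_sum_list_eq[symmetric]) (auto simp: sum_list_map_add)
  qed
  have D01: "D t = {} \<or> D t = {..<m}" for t
  proof -
    have "sum_list (z (t + 1)) - sum_list (z t)
        = (\<Sum>k<m. max (x ! k) (y ! k + (t + 1)) - max (x ! k) (y ! k + t))"
      by (simp add: z_def interv_sum_list_conv_sum_set_nat atLeast0LessThan sum_subtractf)
    also have "\<dots> = (\<Sum>k<m. if x ! k \<le> y ! k + t then 1 else 0)"
      by (intro sum.cong) auto
    also have "\<dots> = int (card (D t))"
      by (simp add: D_def sum.If_cases Int_def conj_commute)
    finally have "int m dvd int (card (D t))"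
      using fixed_list_sum_mod[OF assms(1,2) lenz assms(4) fixz, of "t + 1"]
        fixed_list_sum_mod[OF assms(1,2) lenz assms(4) fixz, of t]
      by (metis mod_eq_dvd_iff)
    then have "m dvd card (D t)" by simp
    moreover have "D t \<subseteq> {..<m}" by (auto simp: D_def)
    then have "card (D t) \<le> m" using card_mono[of "{..<m}"] by force
    ultimately have "card (D t) = 0 \<or> card (D t) = m"
      using dvd_imp_le by (metis le_antisym not_gr_zero)
    then show ?thesis
      using \<open>D t \<subseteq> {..<m}\<close> card_subset_eq[of "{..<m}" "D t"] finite_subset[of "D t" "{..<m}"] by auto
  qed
  \<comment> \<open>The threshold of position 0, which is that of every position since
    \<open>D\<close> is empty or full.\<close>
  define t where "t = x ! 0 - y ! 0"
  have "0 \<in> D t" "0 \<notin> D (t - 1)" using assms(1) by (auto simp: D_def t_def)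
  then have D: "D t = {..<m}" "D (t - 1) = {}" using D01 assms(1) by blast+
  have "x ! k = y ! k + t" if "k < m" for k
  proof -
    have "k \<in> D t" "k \<notin> D (t - 1)" using D that by auto
    then show ?thesis using that by (auto simp: D_def)
  qed
  then have "x = map (\<lambda>a. a + t) y" using x(1) y(1) by (intro nth_equalityI) auto
  then show ?thesis by (rule that)
qed

section \<open>From stable affine permutations to fixed lists\<close>

text \<open>The Minkowski sum of \<open>G\<close> and the nonnegative multiples of
  \<open>m\<close>.\<close>

definition upward_closure :: "nat \<Rightarrow> int set \<Rightarrow> int set" where
  "upward_closure m G = {a. \<exists>g\<in>G. g \<le> a \<and> int m dvd a - g}"

lemma int_dvd_nonneg:
  assumes "int m dvd d" "- int m < d"
  shows "0 \<le> d"
  using zdvd_imp_le[of "int m" "- d"] assms by (cases "d < 0") auto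

text \<open>The window contains one number from each residue class but that of \<open>v\<close>; it
  lies in the closure iff its class has a generator below \<open>v\<close>. This turns a letter of
  the Pak--Stanley word into a rank among generators.\<close>

lemma card_upward_closure_window:
  assumes "m > 0" "inj_on (\<lambda>a. a mod int m) G" "v \<in> G"
  shows "card {a \<in> upward_closure m G. v - int m < a \<and> a < v} = card {g \<in> G. g < v}"
proof -
  let ?f = "\<lambda>a. a mod int m" and ?A = "{a \<in> upward_closure m G. v - int m < a \<and> a < v}"
    and ?B = "{g \<in> G. g < v}"
  have "inj_on ?f ?A"
  proof (rule inj_onI)
    fix a b assume ab: "a \<in> ?A" "b \<in> ?A" and "a mod int m = b mod int m"
    then have "int m dvd a - b" by (simp only: mod_eq_dvd_iff)
    moreover have "\<bar>a - b\<bar> < int m" using ab by auto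
    ultimately show "a = b" using dvd_imp_le_int[of "a - b" "int m"] by fastforce
  qed
  moreover have "inj_on ?f ?B" using assms(2) by (rule inj_on_subset) auto
  moreover have "?f ` ?A = ?f ` ?B"
  proof
    show "?f ` ?A \<subseteq> ?f ` ?B"
    proof
      fix r assume "r \<in> ?f ` ?A"
      then obtain a g where "r = a mod int m" "a < v" "g \<in> G" "g \<le> a" "int m dvd a - g"
        by (auto simp: upward_closure_def)
      moreover from this have "a mod int m = g mod int m" by (simp only: mod_eq_dvd_iff)
      ultimately show "r \<in> ?f ` ?B" by auto
    qed
    show "?f ` ?B \<subseteq> ?f ` ?A"
    proof
      fix r assume "r \<in> ?f ` ?B"
      then obtain g where g: "g \<in> G" "g < v" "r = g mod int m" by blast
      \<comment> \<open>The representative of the class of \<open>g\<close> in the half-open window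
        from \<open>v - m\<close> to \<open>v\<close>. The left end is impossible, as
        \<open>v\<close> is the only generator in its class.\<close>
      define a where "a = v - int m + (g - v) mod int m"
      have "0 \<le> (g - v) mod int m" "(g - v) mod int m < int m" using assms(1) by auto
      then have a: "v - int m \<le> a" "a < v" by (auto simp: a_def)
      have "a - g = int m * (- 1 - (g - v) div int m)"
        using minus_mult_div_eq_mod[of "g - v" "int m"] by (simp add: a_def algebra_simps)
      then have dvd: "int m dvd a - g" by simp
      have "a \<noteq> v - int m"
      proof
        assume "a = v - int m"
        then have e: "a - g = (v - g) - int m" by simp
        have "int m dvd (v - g) - int m" using dvd unfolding e .
        then have "int m dvd v - g" using dvd_diff_left_iff[of "int m" "int m" "v - g"] by simp
        then have "v mod int m = g mod int m" by (simp only: mod_eq_dvd_iff)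
        then show False using inj_onD[OF assms(2) _ assms(3) g(1)] g(2) by simp
      qed
      moreover have "g \<le> a"
        using int_dvd_nonneg[OF dvd] a(1) g(2) by simp
      ultimately have "a \<in> ?A" using a g dvd by (auto simp: upward_closure_def)
      moreover have "r = a mod int m" using dvd g(3) by (metis mod_eq_dvd_iff)
      ultimately show "r \<in> ?f ` ?A" by blast
    qed
  qed
  ultimately show ?thesis using card_image[of ?f ?A] card_image[of ?f ?B] by argo
qed

lemma nth_card_less:
  fixes v :: int
  assumes "sorted xs" "distinct xs" "k < length xs"
  shows "card {g \<in> set xs. g < xs ! k} = k"
proof -
  have lt: "xs ! i < xs ! j" if "i < j" "j < length xs" for i j
    using that assms(1,2) sorted_wrt_nth_less[of "(<)" xs i j] by (simp add: strict_sorted_iff)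
  have "{g \<in> set xs. g < xs ! k} = (!) xs ` {..<k}"
  proof (intro equalityI subsetI)
    fix g assume "g \<in> {g \<in> set xs. g < xs ! k}"
    then obtain i where i: "i < length xs" "g = xs ! i" "xs ! i < xs ! k"
      by (auto simp: in_set_conv_nth)
    then have "i < k" using lt[of k i] by (cases i k rule: linorder_cases) auto
    then show "g \<in> (!) xs ` {..<k}" using i(2) by blast
  qed (use assms(3) lt in auto)
  moreover have "inj_on ((!) xs) {..<k}"
    using assms(2,3) by (auto simp: inj_on_def nth_eq_iff_index_eq)
  ultimately show ?thesis by (simp add: card_image)
qed

text \<open>List index \<open>k\<close> belongs to position \<open>k + 1\<close>. The image includes
  \<open>w (k + 1)\<close> itself, which the strict window discards.\<close>

lemma pak_stanley_nth:
  assumes "inj w" "k < n"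
  shows "pak_stanley m n w ! k
    = card {a \<in> w ` {int k + 1..}. w (int k + 1) - int m < a \<and> a < w (int k + 1)}"
proof -
  let ?J = "{j::nat. j > k + 1 \<and> w (int j) < w (int (k + 1)) \<and> w (int (k + 1)) - w (int j) < int m}"
  have "pak_stanley m n w ! k = card ?J"
    using assms(2) by (simp add: pak_stanley_def nth_map_upt del: upt_Suc)
  also have "\<dots> = card ((\<lambda>j. w (int j)) ` ?J)"
    using assms(1) by (intro card_image[symmetric] inj_onI) (simp add: inj_eq)
  also have "(\<lambda>j. w (int j)) ` ?J
      = {a \<in> w ` {int k + 1..}. w (int k + 1) - int m < a \<and> a < w (int k + 1)}"
  proof (intro equalityI subsetI)
    fix a assume "a \<in> {a \<in> w ` {int k + 1..}. w (int k + 1) - int m < a \<and> a < w (int k + 1)}"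
    then obtain j where j: "a = w j" "j \<ge> int k + 1" "w (int k + 1) - int m < a" "a < w (int k + 1)"
      by auto
    then have "j \<noteq> int k + 1" by auto
    then have "nat j \<in> ?J" "int (nat j) = j" using j by (auto simp: add.commute)
    then show "a \<in> (\<lambda>j. w (int j)) ` ?J" using j(1) by force
  qed (auto simp: add.commute)
  finally show ?thesis .
qed

lemma length_pak_stanley [simp]: "length (pak_stanley m n w) = n"
  by (simp add: pak_stanley_def del: upt_Suc)

text \<open>The witness lists the minimal generators for position 1. The last conjunct recovers the
  window of \<open>w\<close> from word and list, reducing injectivity to uniqueness of fixed lists
  up to translation.\<close>

lemma stable_perm_list:
  assumes "m > 0" and w: "bij w" "\<And>i. w (i + int n) = w i + int n"
    and stable: "\<And>i j. i < j \<Longrightarrow> w i - w j \<noteq> int m"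
  defines "p \<equiv> pak_stanley m n w"
  shows "\<exists>x. length x = m \<and> sorted x \<and> set p \<subseteq> {..<m} \<and> bumps m p x = map (\<lambda>a. a + int n) x \<and>
    (\<forall>k<n. w (int k + 1) = bumps m (take k p) x ! (p ! k))"
proof -
  have wi: "w (inv w i) = i" "inv w (w i) = i" for i
    using w(1) by (simp_all add: bij_is_surj bij_is_inj surj_f_inv_f inv_f_f)
  have invn: "inv w (i + int n) = inv w i + int n" for i by (metis w(2) wi)
  have invn': "inv w (i - int n) = inv w i - int n" for i
    using invn[of "i - int n"] by simp
  \<comment> \<open>Stability means that \<open>inv w\<close> increases along progressions with
    difference \<open>m\<close>.\<close>
  have incr: "inv w (a - int m) < inv w a" for a
  proof (rule ccontr)
    assume "\<not> inv w (a - int m) < inv w a"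
    moreover have "inv w (a - int m) \<noteq> inv w a"
      using assms(1) wi(1)[of a] wi(1)[of "a - int m"] by auto
    ultimately show False using stable[of "inv w a" "inv w (a - int m)"] by (simp add: wi)
  qed
  have incr_nat: "inv w a + int k \<le> inv w (a + int k * int m)" for a k
  proof (induction k)
    case (Suc k)
    then show ?case using incr[of "a + int (Suc k) * int m"] by (simp add: algebra_simps)
  qed simp
  \<comment> \<open>The minimal generators: \<open>a\<close> is a value at a position from
    \<open>i\<close> on, but \<open>a - m\<close> is not.\<close>
  define G where "G i = {a. i \<le> inv w a \<and> inv w (a - int m) < i}" for i
  have G_unique: "a = b" if "a \<in> G i" "b \<in> G i" "int m dvd a - b" for a b i
  proof -
    have "a = b" if "a \<in> G i" "b \<in> G i" "a \<ge> b" and dvd: "int m dvd a - b" for a b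
    proof (rule ccontr)
      assume "a \<noteq> b"
      obtain k where k: "a - b = int m * k" using dvd by (rule dvdE)
      moreover have "0 < a - b" using \<open>a \<noteq> b\<close> \<open>a \<ge> b\<close> by simp
      ultimately have "k > 0" using assms(1) by (simp add: zero_less_mult_iff)
      then have e: "b + int (nat (k - 1)) * int m = a - int m" using k by (simp add: algebra_simps)
      have "inv w b \<le> inv w (a - int m)"
        using incr_nat[of b "nat (k - 1)"] unfolding e by linarith
      then show False using that(1,2) by (simp add: G_def)
    qed
    then show ?thesis using that by (metis dvd_diff_commute linear)
  qed
  have G_below: "\<exists>g\<in>G i. g \<le> a \<and> int m dvd a - g" if "i \<le> inv w a" for a i
  proof -
    \<comment> \<open>Descending from \<open>a\<close> by \<open>m\<close>, \<open>inv w\<close>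
      drops by at least 1 per step; the last number before it falls below \<open>i\<close> is the
      generator.\<close>
    define Q where "Q k \<longleftrightarrow> inv w (a - int k * int m) < i" for k
    have le: "inv w (a - int k * int m) \<le> inv w a - int k" for k
      using incr_nat[of "a - int k * int m" k] by simp
    have e: "int (nat (inv w a - i + 1)) = inv w a - i + 1" using that by simp
    have "Q (nat (inv w a - i + 1))"
      using le[of "nat (inv w a - i + 1)"] unfolding Q_def e by linarith
    then have L: "Q (LEAST k. Q k)" by (rule LeastI)
    moreover have "\<not> Q 0" using that by (simp add: Q_def)
    ultimately obtain k where k: "(LEAST k. Q k) = Suc k" by (metis old.nat.exhaust)
    then have "\<not> Q k" using not_less_Least[of k Q] by simp
    then have "a - int k * int m \<in> G i"
      using L unfolding k by (simp add: G_def Q_def algebra_simps)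
    then show ?thesis by (intro bexI[of _ "a - int k * int m"]) auto
  qed
  have G_inj: "inj_on (\<lambda>a. a mod int m) (G i)" for i
    by (rule inj_onI) (metis G_unique mod_eq_dvd_iff)
  have G_image: "(\<lambda>a. a mod int m) ` G i = {0..<int m}" for i
  proof
    show "(\<lambda>a. a mod int m) ` G i \<subseteq> {0..<int m}" using assms(1) by auto
    show "{0..<int m} \<subseteq> (\<lambda>a. a mod int m) ` G i"
    proof
      fix r assume r: "r \<in> {0..<int m}"
      define k where "k = nat (i - inv w r)"
      have "i \<le> inv w r + int k" by (simp add: k_def)
      then have "i \<le> inv w (r + int k * int m)" using incr_nat[of r k] by linarith
      from G_below[OF this] obtain g where "g \<in> G i" "int m dvd (r + int k * int m) - g" by blast
      then have "(r + int k * int m) mod int m = g mod int m" by (simp only: mod_eq_dvd_iff)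
      then have "r = g mod int m" using r by simp
      then show "r \<in> (\<lambda>a. a mod int m) ` G i" using \<open>g \<in> G i\<close> by blast
    qed
  qed
  have finG: "finite (G i)" for i by (rule finite_imageD[OF _ G_inj]) (simp add: G_image)
  have cardG: "card (G i) = m" for i using card_image[OF G_inj[of i]] by (simp add: G_image)
  have closure: "upward_closure m (G i) = w ` {i..}" for i
  proof (intro equalityI subsetI)
    fix a assume "a \<in> upward_closure m (G i)"
    then obtain g k where g: "g \<in> G i" "g \<le> a" "a - g = int m * k"
      by (auto simp: upward_closure_def dvd_def)
    then have "0 \<le> int m * k" by linarith
    then have "k \<ge> 0" using assms(1) by (simp add: zero_le_mult_iff)
    then have e: "g + int (nat k) * int m = a" using g by (simp add: algebra_simps)
    have "inv w g \<le> inv w a" using incr_nat[of g "nat k"] unfolding e by linarith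
    then have "i \<le> inv w a" using g(1) by (simp add: G_def)
    then show "a \<in> w ` {i..}" by (intro image_eqI[of _ _ "inv w a"]) (simp_all add: wi)
  next
    fix a assume "a \<in> w ` {i..}"
    then show "a \<in> upward_closure m (G i)" using G_below[of i a] by (auto simp: upward_closure_def wi)
  qed
  have wG: "w i \<in> G i" for i using incr[of "w i"] by (simp add: G_def wi)
  have wmG: "w i + int m \<notin> G i" for i by (simp add: G_def wi)
  \<comment> \<open>Removing position \<open>i\<close> makes exactly one number newly minimal, the
    one \<open>m\<close> above \<open>w i\<close>.\<close>
  have G_Suc: "G (i + 1) = insert (w i + int m) (G i - {w i})" for i
  proof (intro equalityI subsetI)
    fix a assume "a \<in> G (i + 1)"
    then have a: "i + 1 \<le> inv w a" "inv w (a - int m) < i + 1" by (auto simp: G_def)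
    show "a \<in> insert (w i + int m) (G i - {w i})"
    proof (cases "inv w (a - int m) = i")
      case True
      then have "a = w i + int m" using wi(1)[of "a - int m"] by simp
      then show ?thesis by simp
    next
      case False
      then show ?thesis using a by (auto simp: G_def wi)
    qed
  next
    fix a assume "a \<in> insert (w i + int m) (G i - {w i})"
    moreover have "inv w a \<noteq> i" if "a \<noteq> w i" using that wi(1)[of a] by auto
    ultimately show "a \<in> G (i + 1)" using incr[of "w i + int m"] by (auto simp: G_def wi)
  qed
  define X where "X i = sorted_list_of_set (G i)" for i
  have X: "set (X i) = G i" "sorted (X i)" "distinct (X i)" "length (X i) = m" for i
    using finG by (simp_all add: X_def cardG)
  define P where "P i = card {g \<in> G i. g < w i}" for i
  have P: "P i < m" "X i ! P i = w i" for i
  proof -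
    obtain k where "k < length (X i)" "X i ! k = w i"
      using wG[of i] X(1)[of i] by (metis in_set_conv_nth)
    moreover from this have "P i = k" using nth_card_less[OF X(2)[of i] X(3)[of i], of k] X(1)[of i]
      by (simp add: P_def)
    ultimately show "P i < m" "X i ! P i = w i" using X(4) by auto
  qed
  have X_Suc: "X (i + 1) = bump m (P i) (X i)" for i
  proof (rule sorted_distinct_set_unique)
    show "sorted (bump m (P i) (X i))" by (rule sorted_bump[OF X(2)])
    have sub: "set (take (P i) (X i) @ drop (Suc (P i)) (X i)) \<subseteq> set (X i)"
      by (auto dest: in_set_takeD in_set_dropD)
    have "distinct (take (P i) (X i) @ X i ! P i # drop (Suc (P i)) (X i))"
      by (metis X(3) X(4) P(1) id_take_nth_drop)
    then have "distinct (take (P i) (X i) @ drop (Suc (P i)) (X i))" by auto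
    then show "distinct (bump m (P i) (X i))"
      unfolding bump_def distinct_insort using sub wmG[of i] X(1)[of i] P(2)[of i] by auto
    show "set (X (i + 1)) = set (bump m (P i) (X i))"
      by (simp add: set_bump X P G_Suc)
  qed (rule X)+
  have pnth: "p ! k = P (int k + 1)" if "k < n" for k
    using pak_stanley_nth[OF bij_is_inj[OF w(1)] that, of m]
      card_upward_closure_window[OF assms(1) G_inj wG, of "int k + 1"]
    by (simp add: p_def P_def closure)
  have lenp: "length p = n" by (simp add: p_def)
  have take: "bumps m (take k p) (X 1) = X (int k + 1)" if "k \<le> n" for k
    using that
  proof (induction k)
    case (Suc k)
    then have "bumps m (take (Suc k) p) (X 1) = bump m (p ! k) (X (int k + 1))"
      using lenp by (simp add: take_Suc_conv_app_nth)
    then show ?case using Suc.prems pnth[of k] X_Suc[of "int k + 1"] by (simp add: add.commute)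
  qed simp
  \<comment> \<open>Closes the cycle: the bumps of the whole word amount to a translation by
    \<open>n\<close>.\<close>
  have "G (i + int n) = (\<lambda>a. a + int n) ` G i" for i
  proof (intro equalityI subsetI)
    fix a assume "a \<in> G (i + int n)"
    then have "a - int n \<in> G i"
      using invn'[of a] invn'[of "a - int m"] by (simp add: G_def algebra_simps)
    then show "a \<in> (\<lambda>a. a + int n) ` G i" by (metis diff_add_cancel image_eqI)
  next
    fix a assume "a \<in> (\<lambda>a. a + int n) ` G i"
    then obtain b where "b \<in> G i" "a = b + int n" by blast
    then show "a \<in> G (i + int n)"
      using invn[of b] invn[of "b - int m"] by (simp add: G_def algebra_simps)
  qed
  then have "X (1 + int n) = map (\<lambda>a. a + int n) (X 1)"
    using X by (intro sorted_distinct_set_unique) (auto simp: sorted_map distinct_map)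
  moreover have "set p \<subseteq> {..<m}"
    using pnth lenp P(1) by (auto simp: in_set_conv_nth)
  ultimately show ?thesis
    using take[of n] take pnth P(2) X lenp by (intro exI[of _ "X 1"]) (simp add: add.commute)
qed

section \<open>From fixed lists to stable affine permutations\<close>

text \<open>The trivial case \<open>i = 0\<close> is added so that all prefixes are treated
  alike.\<close>

lemma parking_words_iff:
  assumes "m > 0"
  shows "p \<in> parking_words m n \<longleftrightarrow> length p = n \<and> set p \<subseteq> {..<m} \<and>
    (\<forall>i\<le>m. i * n \<le> m * length (filter (\<lambda>q. q < i) p))"
proof -
  have "real (card {j. j < n \<and> p ! j < i}) \<ge> real (i * n) / real m
      \<longleftrightarrow> i * n \<le> m * length (filter (\<lambda>q. q < i) p)" if "length p = n" for i
  proof -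
    have "card {j. j < n \<and> p ! j < i} = length (filter (\<lambda>q. q < i) p)"
      using that by (simp add: length_filter_conv_card)
    then have "real (card {j. j < n \<and> p ! j < i}) \<ge> real (i * n) / real m
      \<longleftrightarrow> real (i * n) \<le> real (m * length (filter (\<lambda>q. q < i) p))"
      using assms by (simp add: pos_divide_le_eq mult.commute)
    then show ?thesis by (simp only: of_nat_le_iff)
  qed
  moreover have "(\<forall>i\<in>{1..m}. i * n \<le> m * length (filter (\<lambda>q. q < i) p))
      \<longleftrightarrow> (\<forall>i\<le>m. i * n \<le> m * length (filter (\<lambda>q. q < i) p))"
  proof (intro iffI allI impI ballI)
    fix i assume "\<forall>i\<in>{1..m}. i * n \<le> m * length (filter (\<lambda>q. q < i) p)" "i \<le> m"
    then show "i * n \<le> m * length (filter (\<lambda>q. q < i) p)" by (cases "i = 0") auto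
  qed auto
  ultimately show ?thesis
    by (auto simp: parking_words_def atLeast0LessThan)
qed

section \<open>Bumps of lists with distinct residues\<close>

lemma distinct_residues_bump:
  assumes "p < length xs"
  shows "distinct (map (\<lambda>a. a mod int m) (bump m p xs)) \<longleftrightarrow> distinct (map (\<lambda>a. a mod int m) xs)"
proof -
  have "mset (map (\<lambda>a. a mod int m) (bump m p xs)) = mset (map (\<lambda>a. a mod int m) xs)"
    using arg_cong[OF add_mset_bump[OF assms, of m], of "image_mset (\<lambda>a. a mod int m)"] by simp
  then show ?thesis by (rule mset_eq_imp_distinct_iff)
qed

lemma distinct_residues_bumps:
  assumes "set p \<subseteq> {..<length xs}"
  shows "distinct (map (\<lambda>a. a mod int m) (bumps m p xs)) \<longleftrightarrow> distinct (map (\<lambda>a. a mod int m) xs)"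
  using assms by (induction p arbitrary: xs) (auto simp: distinct_residues_bump length_bump)

text \<open>Distinct residues make \<open>xs ! p\<close> the only generator of its class; without
  it, that class starts at \<open>xs ! p + m\<close>.\<close>

lemma upward_closure_bump:
  assumes "m > 0" "distinct (map (\<lambda>a. a mod int m) xs)" "p < length xs"
  shows "upward_closure m (set (bump m p xs)) = upward_closure m (set xs) - {xs ! p}"
proof -
  have dist: "distinct xs" and inj: "inj_on (\<lambda>a. a mod int m) (set xs)"
    using assms(2) by (auto simp: distinct_map)
  have mem: "xs ! p \<in> set xs" using assms(3) by simp
  have set: "set (bump m p xs) = insert (xs ! p + int m) (set xs - {xs ! p})"
    by (rule set_bump[OF assms(3) dist])
  show ?thesis
  proof (intro equalityI subsetI)
    fix a assume "a \<in> upward_closure m (set (bump m p xs))"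
    then obtain g where g: "g = xs ! p + int m \<or> g \<in> set xs \<and> g \<noteq> xs ! p" "g \<le> a" "int m dvd a - g"
      unfolding upward_closure_def set by blast
    from g(1) show "a \<in> upward_closure m (set xs) - {xs ! p}"
    proof
      assume e: "g = xs ! p + int m"
      then have "int m dvd (a - xs ! p) - int m" using g(3) by (simp add: diff_diff_eq)
      then have "int m dvd a - xs ! p" using dvd_diff_left_iff[of "int m" "int m" "a - xs ! p"] by simp
      then show ?thesis using mem e g(2) assms(1) by (auto simp: upward_closure_def intro!: bexI[of _ "xs ! p"])
    next
      assume gx: "g \<in> set xs \<and> g \<noteq> xs ! p"
      have "a mod int m = g mod int m" using g(3) by (simp only: mod_eq_dvd_iff)
      then have "a \<noteq> xs ! p" using inj_onD[OF inj, of "xs ! p" g] gx mem by auto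
      then show ?thesis using g gx by (auto simp: upward_closure_def)
    qed
  next
    fix a assume "a \<in> upward_closure m (set xs) - {xs ! p}"
    then obtain g where g: "g \<in> set xs" "g \<le> a" "int m dvd a - g" and ne: "a \<noteq> xs ! p"
      by (auto simp: upward_closure_def)
    show "a \<in> upward_closure m (set (bump m p xs))"
    proof (cases "g = xs ! p")
      case True
      then have "int m \<le> a - xs ! p" using g ne by (intro zdvd_imp_le) auto
      moreover have "int m dvd (a - xs ! p) - int m"
        using g(3) True dvd_diff_left_iff[of "int m" "int m" "a - xs ! p"] by simp
      then have "int m dvd a - (xs ! p + int m)" by (simp add: diff_diff_eq)
      ultimately show ?thesis unfolding upward_closure_def set by force
    qed (use g in \<open>auto simp: upward_closure_def set\<close>)
  qed
qed

text \<open>Running the word periodically yields lists \<open>X i\<close> for all integers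
  \<open>i\<close>, whose closures lose one element \<open>w i\<close> per step. Every integer lies
  in some closure but not in all, so it is removed exactly once.\<close>

lemma fixed_list_perm:
  assumes "m > 0" "n > 0" "length p = n" "set p \<subseteq> {..<m}"
    and y: "length y = m" "sorted y" "distinct (map (\<lambda>a. a mod int m) y)"
      "bumps m p y = map (\<lambda>a. a + int n) y"
  obtains w where "bij w" "\<And>i. w (i + int n) = w i + int n"
    "\<And>i j. i < j \<Longrightarrow> w i - w j \<noteq> int m" "pak_stanley m n w = p"
proof -
  \<comment> \<open>\<open>r i\<close> is the zero-based index of the letter used at step
    \<open>i\<close>; \<open>q i\<close> numbers its period.\<close>
  define r where "r i = nat ((i - 1) mod int n)" for i
  define q where "q i = (i - 1) div int n" for i
  \<comment> \<open>\<open>X 1 = y\<close>, so that positions in the word start at 1 as in the window of \<open>w\<close>.\<close>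
  define X where "X i = map (\<lambda>a. a + q i * int n) (bumps m (take (r i) p) y)" for i
  define P where "P i = p ! r i" for i
  have r_lt: "r i < n" for i using assms(2) by (simp add: r_def nat_less_iff)
  have i_eq: "i = 1 + int (r i) + q i * int n" for i
    using assms(2) mult_div_mod_eq[of "int n" "i - 1"] by (simp add: r_def q_def mult.commute)
  have rq: "r (1 + int k + c * int n) = k" "q (1 + int k + c * int n) = c" if "k < n" for k c
    using that assms(2) by (simp_all add: r_def q_def)
  have P_lt: "P i < m" for i
  proof -
    have "p ! r i \<in> set p" using r_lt[of i] assms(3) by simp
    then show ?thesis using assms(4) by (auto simp: P_def)
  qed
  have sub: "set (take k p) \<subseteq> {..<length y}" for k
    using subset_trans[OF set_take_subset assms(4)] y(1) by simp
  have len: "length (X i) = m" and srt: "sorted (X i)" for i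
    using y length_bumps[OF sub] sorted_bumps[OF y(2)] by (simp_all add: X_def sorted_map)
  have res: "distinct (map (\<lambda>a. a mod int m) (X i))" for i
  proof -
    let ?L = "bumps m (take (r i) p) y"
    have "distinct (map (\<lambda>a. a mod int m) ?L)"
      using y(3) distinct_residues_bumps[OF sub] by blast
    then have L: "distinct ?L" "inj_on (\<lambda>a. a mod int m) (set ?L)" by (simp_all add: distinct_map)
    have "inj_on (\<lambda>a. (a + q i * int n) mod int m) (set ?L)"
    proof (rule inj_onI)
      fix a b assume ab: "a \<in> set ?L" "b \<in> set ?L"
        and "(a + q i * int n) mod int m = (b + q i * int n) mod int m"
      then have "a mod int m = b mod int m" by (simp add: mod_eq_dvd_iff)
      then show "a = b" using inj_onD[OF L(2)] ab by blast
    qed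
    then show ?thesis using L(1) by (simp add: X_def distinct_map comp_def)
  qed
  have X_Suc: "X (i + 1) = bump m (P i) (X i)" for i
  proof -
    have "bump m (P i) (X i) = map (\<lambda>a. a + q i * int n) (bump m (P i) (bumps m (take (r i) p) y))"
      unfolding X_def using P_lt[of i] length_bumps[OF sub] y(1) by (intro bump_map_add) simp
    also have "bump m (P i) (bumps m (take (r i) p) y) = bumps m (take (Suc (r i)) p) y"
      using take_Suc_conv_app_nth[of "r i" p] r_lt[of i] assms(3) by (simp add: P_def)
    finally have e: "bump m (P i) (X i) = map (\<lambda>a. a + q i * int n) (bumps m (take (Suc (r i)) p) y)" .
    show ?thesis
    proof (cases "Suc (r i) < n")
      case True
      have "i + 1 = 1 + int (Suc (r i)) + q i * int n" using i_eq[of i] by simp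
      then have "r (i + 1) = Suc (r i)" "q (i + 1) = q i" using rq[OF True, of "q i"] by metis+
      then show ?thesis using e by (simp add: X_def)
    next
      \<comment> \<open>The whole word has acted; fixedness of \<open>y\<close> turns this into the
        translation by \<open>n\<close> counted by \<open>q\<close>.\<close>
      case False
      then have "Suc (r i) = n" using r_lt[of i] by simp
      moreover from this have "i + 1 = 1 + int 0 + (q i + 1) * int n"
        using i_eq[of i] by (simp add: algebra_simps)
      then have "r (i + 1) = 0" "q (i + 1) = q i + 1" using rq[OF assms(2), of "q i + 1"] by metis+
      ultimately show ?thesis using e assms(3) y(4) by (simp add: X_def algebra_simps)
    qed
  qed
  have per: "r (i + int n) = r i" "q (i + int n) = q i + 1" for i
    using assms(2) div_add_self2[of "int n" "i - 1"] mod_add_self2[of "i - 1" "int n"]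
    by (simp_all add: r_def q_def algebra_simps)
  define w where "w i = X i ! P i" for i
  define S where "S i = upward_closure m (set (X i))" for i
  have w_per: "w (i + int n) = w i + int n" for i
    using P_lt[of i] length_bumps[OF sub] y(1)
    by (simp add: w_def X_def P_def per algebra_simps)
  have wX: "w i \<in> set (X i)" for i using P_lt len by (simp add: w_def)
  then have wS: "w i \<in> S i" for i by (auto simp: S_def upward_closure_def)
  have S_Suc: "S (i + 1) = S i - {w i}" for i
    unfolding S_def X_Suc w_def using P_lt len by (intro upward_closure_bump[OF assms(1) res]) simp
  have S_anti: "S j \<subseteq> S i" if "i \<le> j" for i j
    using that by (induction j rule: int_ge_induct) (auto simp: S_Suc)
  have w_notin: "w i \<notin> S j" if "i < j" for i j
    using S_anti[of "i + 1" j] that by (auto simp: S_Suc)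
  have S_mono: "a + int m \<in> S i" if a: "a \<in> S i" for a i
  proof -
    obtain g where "g \<in> set (X i)" "g \<le> a" "int m dvd a - g"
      using a by (auto simp: S_def upward_closure_def)
    moreover from this have "int m dvd (a - g) + int m" by simp
    then have "int m dvd a + int m - g" by (simp add: algebra_simps)
    ultimately show ?thesis unfolding S_def upward_closure_def by (intro CollectI bexI[of _ g]) auto
  qed
  have X1: "X (1 + c * int n) = map (\<lambda>a. a + c * int n) y" for c
    using rq[OF assms(2), of c] by (simp add: X_def)
  have ex_in: "\<exists>i. a \<in> S i" for a
  proof -
    have "inj_on (\<lambda>a. a mod int m) (set y)" "distinct y" using y(3) by (auto simp: distinct_map)
    then have "card ((\<lambda>a. a mod int m) ` set y) = m"
      using y(1) by (simp add: card_image distinct_card)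
    moreover have "(\<lambda>a. a mod int m) ` set y \<subseteq> {0..<int m}" using assms(1) by auto
    ultimately have "(\<lambda>a. a mod int m) ` set y = {0..<int m}" by (intro card_subset_eq) auto
    moreover have "a mod int m \<in> {0..<int m}" using assms(1) by simp
    ultimately obtain g where g: "g \<in> set y" "a mod int m = g mod int m" by (metis imageE)
    \<comment> \<open>Shifts \<open>g\<close> by a multiple of \<open>m\<close>, which keeps its
      class, far enough to reach \<open>a\<close> or below.\<close>
    define c where "c = - (int m * \<bar>g - a\<bar>)"
    have "1 * \<bar>g - a\<bar> \<le> (int m * int n) * \<bar>g - a\<bar>"
      using assms(1,2) by (intro mult_right_mono) (auto simp flip: of_nat_mult)
    then have "g + c * int n \<le> a" by (simp add: c_def algebra_simps)
    moreover have "int m dvd (a - g) + int m * (\<bar>g - a\<bar> * int n)"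
      using g(2) by (simp add: mod_eq_dvd_iff)
    then have "int m dvd a - (g + c * int n)" by (simp add: c_def algebra_simps)
    ultimately have "a \<in> S (1 + c * int n)"
      using g(1) by (auto simp: S_def X1 upward_closure_def)
    then show ?thesis ..
  qed
  have ex_notin: "\<exists>i. a \<notin> S i" for a
  proof -
    \<comment> \<open>So many periods later even the least generator exceeds
      \<open>a\<close>.\<close>
    define c where "c = \<bar>a - y ! 0\<bar> + 1"
    have "a < g + c * int n" if "g \<in> set y" for g
    proof -
      have "y ! 0 \<le> g" using that y(2) by (auto simp: in_set_conv_nth sorted_iff_nth_mono)
      moreover have "c * 1 \<le> c * int n" using assms(2) by (intro mult_left_mono) (auto simp: c_def)
      moreover have "a < y ! 0 + c" unfolding c_def by linarith
      ultimately show ?thesis by linarith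
    qed
    then have "a \<notin> S (1 + c * int n)" by (auto simp: S_def X1 upward_closure_def not_le)
    then show ?thesis ..
  qed
  have "\<exists>i. w i = a" for a
  proof (rule ccontr)
    assume "\<nexists>i. w i = a"
    \<comment> \<open>A number never removed stays in all later sets, and earlier sets are
      larger.\<close>
    then have step: "a \<in> S (i + 1)" if "a \<in> S i" for i using that by (auto simp: S_Suc)
    obtain i where i: "a \<in> S i" using ex_in by blast
    have "a \<in> S j" if "i \<le> j" for j
      using that by (induction j rule: int_ge_induct) (auto simp: i step)
    then have "a \<in> S j" for j using S_anti[of j "max i j"] by auto
    then show False using ex_notin by blast
  qed
  then have "surj w" by (metis surjI)
  moreover have "inj w"
  proof (rule injI)
    fix i j assume "w i = w j"
    then show "i = j" using w_notin[of i j] w_notin[of j i] wS by (metis linorder_neqE)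
  qed
  ultimately have bij: "bij w" by (simp add: bij_def)
  have S_eq: "S i = w ` {i..}" for i
  proof (intro equalityI subsetI)
    fix a assume "a \<in> S i"
    moreover obtain j where "a = w j" using \<open>surj w\<close> by (metis surjD)
    ultimately show "a \<in> w ` {i..}" using w_notin[of j i] by force
  next
    fix a assume "a \<in> w ` {i..}"
    then show "a \<in> S i" using wS S_anti by blast
  qed
  have stable: "w i - w j \<noteq> int m" if "i < j" for i j
  proof
    assume "w i - w j = int m"
    then have "w i = w j + int m" by simp
    then show False using S_mono[OF wS[of j]] w_notin[OF that] by simp
  qed
  have "pak_stanley m n w = p"
  proof (rule nth_equalityI)
    fix k assume "k < length (pak_stanley m n w)"
    then have k: "k < n" by simp
    let ?i = "int k + 1"
    have "inj_on (\<lambda>a. a mod int m) (set (X ?i))" "distinct (X ?i)"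
      using res[of ?i] by (auto simp: distinct_map)
    then have "card {a \<in> S ?i. w ?i - int m < a \<and> a < w ?i} = P ?i"
      unfolding S_def using card_upward_closure_window[OF assms(1) _ wX] P_lt len srt
      by (simp add: w_def nth_card_less)
    moreover have "P ?i = p ! k" using rq[OF k, of 0] by (simp add: P_def add.commute)
    ultimately show "pak_stanley m n w ! k = p ! k"
      using pak_stanley_nth[OF \<open>inj w\<close> k, of m] by (simp add: S_eq)
  qed (simp add: assms(3))
  then show ?thesis using that bij w_per stable by blast
qed

text \<open>\<open>w\<close> permutes the residues modulo \<open>n\<close>, so its window sum and
  that of the identity differ by a multiple of \<open>n\<close>, which a translation can
  correct.\<close>

lemma affine_perms_translate:
  assumes "n > 0" "bij w" "\<And>i. w (i + int n) = w i + int n"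
  obtains t where "(\<lambda>i. w i + t) \<in> affine_perms n"
proof -
  have "(\<Sum>i=1..int n. i) mod int n = (\<Sum>i=1..int n. i mod int n) mod int n"
    by (simp add: mod_sum_eq)
  also have "(\<Sum>i=1..int n. i mod int n) = (\<Sum>i=1..int n. w i mod int n)"
    using sum_window_reindex[of n "\<lambda>i. i mod int n" w] assms by (simp add: bij_is_inj)
  also have "\<dots> mod int n = (\<Sum>i=1..int n. w i) mod int n"
    by (simp add: mod_sum_eq)
  finally have "int n dvd (\<Sum>i=1..int n. i) - (\<Sum>i=1..int n. w i)" by (simp only: mod_eq_dvd_iff)
  then obtain t where t: "(\<Sum>i=1..int n. i) - (\<Sum>i=1..int n. w i) = int n * t" by (rule dvdE)
  have "bij (\<lambda>i. w i + t)"
    using bij_comp[OF assms(2), of "\<lambda>a. a + t"] by (simp add: comp_def bij_plus_right)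
  moreover have "(\<Sum>i=1..int n. w i + t) = int ((n + 1) choose 2)"
    using t sum_window[of n] by (simp add: sum.distrib)
  ultimately have "(\<lambda>i. w i + t) \<in> affine_perms n"
    using assms(3) by (simp add: affine_perms_def)
  then show ?thesis by (rule that)
qed

section \<open>The bijection\<close>

theorem theorem6p17:
  fixes m n :: nat
  assumes "m > 0" and "n > 0" and "coprime m n"
  shows "bij_betw (pak_stanley m n)
           {w \<in> affine_perms n. alcove n (inv w) \<subseteq> sommers_region m n}
           (parking_words m n)"
proof -
  let ?D = "{w \<in> affine_perms n. alcove n (inv w) \<subseteq> sommers_region m n}"
  have D: "w \<in> ?D \<longleftrightarrow> w \<in> affine_perms n \<and> (\<forall>i j. i < j \<longrightarrow> w i - w j \<noteq> int m)" for w
    using alcove_inv_subset_sommers_region_iff[OF assms(2,1)] by blast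
  have list: "\<exists>x. length x = m \<and> sorted x \<and> set p \<subseteq> {..<m} \<and> bumps m p x = map (\<lambda>a. a + int n) x \<and>
      (\<forall>k<n. w (int k + 1) = bumps m (take k p) x ! (p ! k))"
    if wD: "w \<in> ?D" and p: "p = pak_stanley m n w" for w p
  proof -
    have w: "bij w" "\<And>i. w (i + int n) = w i + int n" "\<And>i j. i < j \<Longrightarrow> w i - w j \<noteq> int m"
      using wD unfolding D by (auto simp: affine_perms_def)
    show ?thesis unfolding p using stable_perm_list[OF assms(1) w] .
  qed
  show ?thesis
  proof (rule bij_betw_imageI)
    show "inj_on (pak_stanley m n) ?D"
    proof (rule inj_onI)
      fix w v assume wv: "w \<in> ?D" "v \<in> ?D" and eq: "pak_stanley m n w = pak_stanley m n v"
      define p where "p = pak_stanley m n w"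
      obtain x where x: "length x = m" "sorted x" "set p \<subseteq> {..<m}" "bumps m p x = map (\<lambda>a. a + int n) x"
        and wx: "\<And>k. k < n \<Longrightarrow> w (int k + 1) = bumps m (take k p) x ! (p ! k)"
        using list[OF wv(1) p_def] by blast
      obtain y where y: "length y = m" "sorted y" "bumps m p y = map (\<lambda>a. a + int n) y"
        and vy: "\<And>k. k < n \<Longrightarrow> v (int k + 1) = bumps m (take k p) y ! (p ! k)"
        using list[OF wv(2), of p] eq p_def by blast
      \<comment> \<open>The constant by which \<open>w\<close> and \<open>v\<close> differ on the
        window; equal window sums make it 0.\<close>
      obtain t where t: "x = map (\<lambda>a. a + t) y"
        using fixed_list_unique[OF assms(1,3) _ x(3) x(1,2,4) y] by (auto simp: p_def)
      have diff: "w (int k + 1) = v (int k + 1) + t" if k: "k < n" for k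
      proof -
        have sub: "set (take k p) \<subseteq> {..<length y}" 
          using subset_trans[OF set_take_subset x(3)] y(1) by simp
        have "p ! k \<in> set p" using k by (simp add: p_def)
        then have "p ! k < m" using x(3) by auto
        then show ?thesis
          using wx[OF k] vy[OF k] length_bumps[OF sub] y(1) by (simp add: t bumps_map_add[OF sub])
      qed
      have diff': "w i = v i + t" if "i \<in> {1..int n}" for i
        using diff[of "nat (i - 1)"] that by (simp add: nat_less_iff)
      have per: "w (i + int n) = w i + int n" "v (i + int n) = v i + int n" for i
        using wv by (auto simp: affine_perms_def)
      have sums: "(\<Sum>i=1..int n. w i) = (\<Sum>i=1..int n. v i)"
        using wv by (auto simp: affine_perms_def)
      have "(\<Sum>i=1..int n. w i) = (\<Sum>i=1..int n. v i) + int n * t"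
        using diff' by (simp add: sum.distrib)
      then have "t = 0" using sums assms(2) by simp
      show "w = v"
      proof
        fix i
        define r k where "r = (i - 1) mod int n + 1" and "k = (i - 1) div int n"
        have i: "i = r + k * int n"
          unfolding r_def k_def using div_mult_mod_eq[of "i - 1" "int n"] by linarith
        have "r \<in> {1..int n}"
          using assms(2) pos_mod_bound[of "int n" "i - 1"] pos_mod_sign[of "int n" "i - 1"]
          unfolding r_def atLeastAtMost_iff by linarith
        then have "w r = v r" using diff' \<open>t = 0\<close> by simp
        then show "w i = v i"
          using shift_mult[of w n "int n" r k] shift_mult[of v n "int n" r k] per unfolding i by simp
      qed
    qed
    show "pak_stanley m n ` ?D = parking_words m n"
    proof (intro equalityI subsetI)
      fix p assume "p \<in> pak_stanley m n ` ?D"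
      then obtain w where w: "w \<in> ?D" "p = pak_stanley m n w" by blast
      then obtain x where "length x = m" "sorted x" "set p \<subseteq> {..<m}" "bumps m p x = map (\<lambda>a. a + int n) x"
        using list by blast
      then show "p \<in> parking_words m n"
        using fixed_list_parking[of x p _ m n] assms(1) w(2) by (simp add: parking_words_iff)
    next
      fix p assume "p \<in> parking_words m n"
      then have p: "length p = n" "set p \<subseteq> {..<m}"
        and park: "\<And>i. i \<le> m \<Longrightarrow> i * n \<le> m * length (filter (\<lambda>q. q < i) p)"
        using assms(1) by (auto simp: parking_words_iff)
      obtain y where y: "length y = m" "sorted y" "bumps m p y = map (\<lambda>a. a + int n) y"
        using parking_list_fixed_exists[OF assms(1) p park] by blast
      have "distinct (map (\<lambda>a. a mod int m) y)"
        using fixed_list_transversal[OF assms(1,3) y(1) p(2) y(3)] by (simp add: distinct_map bij_betw_def)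
      then obtain w where w: "bij w" "\<And>i. w (i + int n) = w i + int n"
        "\<And>i j. i < j \<Longrightarrow> w i - w j \<noteq> int m" "pak_stanley m n w = p"
        using fixed_list_perm[OF assms(1,2) p y(1,2) _ y(3)] by blast
      \<comment> \<open>Word and stability depend only on differences of values, so the window sum
        can be normalized.\<close>
      obtain t where t: "(\<lambda>i. w i + t) \<in> affine_perms n"
        using affine_perms_translate[OF assms(2) w(1,2)] by blast
      have "(\<lambda>i. w i + t) \<in> ?D" unfolding D using t w(3) by simp
      moreover have "pak_stanley m n (\<lambda>i. w i + t) = p"
        using w(4) by (simp add: pak_stanley_def)
      ultimately show "p \<in> pak_stanley m n ` ?D" by (metis (no_types, lifting) image_eqI)
    qed
  qed
qed

end
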